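(* Let $\Gamma=(V,E)$ be a finite graph with $|V|\ge 2$ such that there are no two distinct vertices $x,y\in V$ with $lk(x)\subset st(y)$. Then the right angled Artin group $R_\Gamma$ admits infinitely many linearly independent homogeneous Aut-invariant quasimorphisms.
   Context: A finite graph $\Gamma=(V,E)$ consists of a non-empty finite vertex set $V$ and a set $E$ of 2-element subsets of $V$ (no loops, no multiple edges). For $v\in V$, $lk(v)=\{x\in V:\{v,x\}\in E\}$ and $st(v)=lk(v)\cup\{v\}$. The right angled Artin group $R_\Gamma$ is the group generated by $V$ subject to the relations $xy=yx$ for all $\{x,y\}\in E$. A quasimorphism on a group $G$ is a map $\psi\colon G\to\mathbb{R}$ with $\sup_{g,h\in G}|\psi(g)+\psi(h)-\psi(gh)|<\infty$; it is homogeneous if $\psi(g^n)=n\psi(g)$ for all $g\in G,n\in\mathbb{Z}$, and Aut-invariant if $\psi\circ\varphi=\psi$ for every automorphism $\varphi$ of $G$. Linear independence refers to the real vector space of functions $G\to\mathbb{R}$. *)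

theory Defs
  imports "HOL-Algebra.Algebra"
begin

definition finite_graph :: "'v set \<Rightarrow> 'v set set \<Rightarrow> bool" where
  "finite_graph V E \<longleftrightarrow> finite V \<and> V \<noteq> {} \<and>
     (\<forall>e\<in>E. e \<subseteq> V \<and> card e = 2)"

definition lk :: "'v set set \<Rightarrow> 'v \<Rightarrow> 'v set" where
  "lk E v = {x. {v, x} \<in> E}"

definition st :: "'v set set \<Rightarrow> 'v \<Rightarrow> 'v set" where
  "st E v = insert v (lk E v)"

text \<open>Words in the generators and their inverses: a letter (v, True) is v,
(v, False) is v inverse.  One elementary move: cancel/insert a pair v v^-1
(or v^-1 v), or swap two adjacent letters whose generators are adjacent.\<close>

inductive raag_step :: "'v set \<Rightarrow> 'v set set \<Rightarrow> ('v \<times> bool) list \<Rightarrow> ('v \<times> bool) list \<Rightarrow> bool"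
  for V E where
  cancel: "v \<in> V \<Longrightarrow> raag_step V E (xs @ [(v, b), (v, \<not> b)] @ ys) (xs @ ys)"
| insert: "v \<in> V \<Longrightarrow> raag_step V E (xs @ ys) (xs @ [(v, b), (v, \<not> b)] @ ys)"
| swap: "{u, w} \<in> E \<Longrightarrow> raag_step V E (xs @ [(u, b), (w, c)] @ ys) (xs @ [(w, c), (u, b)] @ ys)"

definition raag_words :: "'v set \<Rightarrow> ('v \<times> bool) list set" where
  "raag_words V = lists (V \<times> UNIV)"

definition raag_equiv :: "'v set \<Rightarrow> 'v set set \<Rightarrow> ('v \<times> bool) list \<Rightarrow> ('v \<times> bool) list \<Rightarrow> bool" where
  "raag_equiv V E = (\<lambda>w w'. (raag_step V E)\<^sup>*\<^sup>* w w')"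

definition raag_class :: "'v set \<Rightarrow> 'v set set \<Rightarrow> ('v \<times> bool) list \<Rightarrow> ('v \<times> bool) list set" where
  "raag_class V E w = {w'. raag_equiv V E w w'}"

definition RAAG :: "'v set \<Rightarrow> 'v set set \<Rightarrow> ('v \<times> bool) list set monoid" where
  "RAAG V E = \<lparr> carrier = raag_class V E ` raag_words V,
     monoid.mult = (\<lambda>A B. {w. \<exists>a\<in>A. \<exists>b\<in>B. raag_equiv V E (a @ b) w}),
     monoid.one = raag_class V E [] \<rparr>"

definition quasimorphism :: "('a, 'b) monoid_scheme \<Rightarrow> ('a \<Rightarrow> real) \<Rightarrow> bool" where
  "quasimorphism G \<psi> \<longleftrightarrow>
     (\<exists>D. \<forall>g\<in>carrier G. \<forall>h\<in>carrier G. \<bar>\<psi> g + \<psi> h - \<psi> (g \<otimes>\<^bsub>G\<^esub> h)\<bar> \<le> D)"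

definition homogeneous :: "('a, 'b) monoid_scheme \<Rightarrow> ('a \<Rightarrow> real) \<Rightarrow> bool" where
  "homogeneous G \<psi> \<longleftrightarrow> (\<forall>g\<in>carrier G. \<forall>n::int. \<psi> (g [^]\<^bsub>G\<^esub> n) = of_int n * \<psi> g)"

definition aut_invariant :: "('a, 'b) monoid_scheme \<Rightarrow> ('a \<Rightarrow> real) \<Rightarrow> bool" where
  "aut_invariant G \<psi> \<longleftrightarrow> (\<forall>\<phi>\<in>iso G G. \<forall>g\<in>carrier G. \<psi> (\<phi> g) = \<psi> g)"

definition lin_indep_fun :: "('a, 'b) monoid_scheme \<Rightarrow> ('i \<Rightarrow> 'a \<Rightarrow> real) \<Rightarrow> 'i set \<Rightarrow> bool" where
  "lin_indep_fun G Q I \<longleftrightarrow>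
     (\<forall>F c. finite F \<and> F \<subseteq> I \<and> (\<forall>g\<in>carrier G. (\<Sum>i\<in>F. c i * Q i g) = 0)
        \<longrightarrow> (\<forall>i\<in>F. c i = 0))"

end

theory Submission
  imports Defs "HOL-Library.Sublist"
begin

text \<open>
  If \<open>g\<close> and \<open>h\<close> commute, \<open>g\<close> has exponent sum zero in \<open>l\<close> and \<open>h\<close> does not, then \<open>g\<close> is
  conjugate to its retraction to the star of \<open>l\<close>. Combined with the commutator relations in degree
  two, the absence of dominated vertices forces every automorphism to send each letter \<open>z\<close> to a
  conjugate of \<open>\<rho> z\<close>, where \<open>\<rho>\<close> is a permutation of the letters compatible with inversion and
  adjacency. Retracting to two nonadjacent generators turns the automorphism into an isomorphism of
  free groups of rank two that maps letters to conjugates of letters, and such a map is \<open>\<rho>\<close> followed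
  by an inner automorphism. Hence a Brooks counting function for a pattern in two letters, summed
  over all pairs of nonadjacent letters, changes by a bounded amount under automorphisms, and its
  homogenization is invariant. Varying the pattern gives the linearly independent family.
\<close>

section \<open>Quasimorphisms and their homogenizations\<close>

definition bounded_difference :: "'a set \<Rightarrow> ('a \<Rightarrow> real) \<Rightarrow> ('a \<Rightarrow> real) \<Rightarrow> bool" where
  "bounded_difference A f g \<longleftrightarrow> (\<exists>C. \<forall>x\<in>A. \<bar>f x - g x\<bar> \<le> C)"

lemma bounded_differenceI: "(\<And>x. x \<in> A \<Longrightarrow> \<bar>f x - g x\<bar> \<le> C) \<Longrightarrow> bounded_difference A f g"
  by (auto simp: bounded_difference_def)

lemma bounded_difference_sym: "bounded_difference A f g \<Longrightarrow> bounded_difference A g f"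
  by (simp add: bounded_difference_def abs_minus_commute)

lemma bounded_difference_trans [trans]:
  assumes "bounded_difference A f g" "bounded_difference A g h" shows "bounded_difference A f h"
proof -
  obtain C D where "\<And>x. x \<in> A \<Longrightarrow> \<bar>f x - g x\<bar> \<le> C" "\<And>x. x \<in> A \<Longrightarrow> \<bar>g x - h x\<bar> \<le> D"
    using assms by (auto simp: bounded_difference_def)
  then have "\<bar>f x - h x\<bar> \<le> C + D" if "x \<in> A" for x using that by fastforce
  then show ?thesis by (rule bounded_differenceI)
qed

lemma bounded_difference_comp:
  "bounded_difference Y f g \<Longrightarrow> \<phi> ` A \<subseteq> Y \<Longrightarrow> bounded_difference A (f \<circ> \<phi>) (g \<circ> \<phi>)"
  by (fastforce simp: bounded_difference_def)

lemma slope_unique: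
  assumes "bounded_difference UNIV a (\<lambda>n. real n * L)" "bounded_difference UNIV a (\<lambda>n. real n * L')"
  shows "L = L'"
proof -
  obtain C where C: "\<And>n. \<bar>real n * L - real n * L'\<bar> \<le> C"
    using bounded_difference_trans[OF bounded_difference_sym[OF assms(1)] assms(2)]
    by (auto simp: bounded_difference_def)
  have "real n * \<bar>L - L'\<bar> = \<bar>real n * L - real n * L'\<bar>" for n
    by (simp add: abs_mult flip: right_diff_distrib)
  then have "\<bar>L - L'\<bar> = 0" using C by (intro real_archimedian_rdiv_eq_0[of _ C]) simp_all
  then show ?thesis by simp
qed

lemma almost_additive_slope:
  fixes a :: "nat \<Rightarrow> real"
  assumes D: "\<And>m n. \<bar>a m + a n - a (m + n)\<bar> \<le> D"
  shows "\<exists>L. \<forall>n. \<bar>a n - real n * L\<bar> \<le> D"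
proof -
  have mult: "\<bar>a (Suc k * n) - real (Suc k) * a n\<bar> \<le> real k * D" for k n
  proof (induction k)
    case (Suc k)
    then show ?case using D[of n "Suc k * n"] by (simp add: algebra_simps)
  qed simp
  let ?lower = "\<lambda>n. (a n - D) / real n" and ?upper = "\<lambda>n. (a n + D) / real n"
  have lower_le_upper: "?lower m \<le> ?upper n" if mn: "m \<ge> 1" "n \<ge> 1" for m n
  proof -
    obtain p q where pq: "m = Suc p" "n = Suc q" using mn by (metis Suc_le_D One_nat_def)
    have "real n * a m - real m * a n \<le> real q * D + real p * D"
      using mult[of q m] mult[of p n] pq by (simp add: mult.commute)
    moreover have "0 \<le> D" using D[of 0 0] by linarith
    ultimately have "real n * (a m - D) \<le> real m * (a n + D)" by (simp add: pq algebra_simps)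
    then show ?thesis using mn by (simp add: field_simps)
  qed
  define L where "L = (SUP n\<in>{1..}. ?lower n)"
  have "?lower n \<le> L" if "n \<ge> 1" for n
    unfolding L_def using that lower_le_upper[of _ 1]
    by (intro cSUP_upper) (auto intro!: bdd_aboveI2)
  moreover have "L \<le> ?upper n" if "n \<ge> 1" for n
    unfolding L_def using that lower_le_upper by (intro cSUP_least) auto
  ultimately have "\<bar>a n - real n * L\<bar> \<le> D" if "n \<ge> 1" for n
    using that by (simp add: abs_le_iff field_simps)
  moreover have "\<bar>a 0\<bar> \<le> D" using D[of 0 0] by simp
  ultimately show ?thesis by (metis less_one mult_zero_left not_le of_nat_0 diff_zero)
qed

lemma (in group) quasimorphism_bounded_difference:
  assumes "quasimorphism G f" "bounded_difference (carrier G) \<psi> f"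
  shows "quasimorphism G \<psi>"
proof -
  obtain D C where D: "\<And>g h. g \<in> carrier G \<Longrightarrow> h \<in> carrier G \<Longrightarrow> \<bar>f g + f h - f (g \<otimes> h)\<bar> \<le> D"
    and C: "\<And>g. g \<in> carrier G \<Longrightarrow> \<bar>\<psi> g - f g\<bar> \<le> C"
    using assms unfolding quasimorphism_def bounded_difference_def by blast
  have "\<bar>\<psi> g + \<psi> h - \<psi> (g \<otimes> h)\<bar> \<le> D + 3 * C" if "g \<in> carrier G" "h \<in> carrier G" for g h
    using D[OF that] C[of g] C[of h] C[of "g \<otimes> h"] that by simp
  then show ?thesis by (auto simp: quasimorphism_def)
qed

lemma (in group) homogeneous_nat_pow:
  "homogeneous G \<psi> \<Longrightarrow> g \<in> carrier G \<Longrightarrow> \<psi> (g [^] (n::nat)) = real n * \<psi> g"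
  unfolding homogeneous_def by (metis int_pow_int of_int_of_nat_eq)

lemma (in group) homogeneous_unique:
  assumes "homogeneous G \<psi>" "homogeneous G \<psi>'" "bounded_difference (carrier G) \<psi> \<psi>'" "g \<in> carrier G"
  shows "\<psi> g = \<psi>' g"
proof (rule slope_unique)
  show "bounded_difference UNIV (\<lambda>n. \<psi> (g [^] (n::nat))) (\<lambda>n. real n * \<psi> g)"
    using homogeneous_nat_pow[OF assms(1,4)] by (auto simp: bounded_difference_def)
  have "bounded_difference UNIV (\<lambda>n. \<psi> (g [^] (n::nat))) (\<lambda>n. \<psi>' (g [^] n))"
    using bounded_difference_comp[OF assms(3), of "\<lambda>n::nat. g [^] n" UNIV] assms(4)
    by (auto simp: comp_def)
  then show "bounded_difference UNIV (\<lambda>n. \<psi> (g [^] (n::nat))) (\<lambda>n. real n * \<psi>' g)"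
    using homogeneous_nat_pow[OF assms(2,4)] by simp
qed

lemma (in group) homogenization:
  assumes "quasimorphism G f"
  obtains \<psi> where "homogeneous G \<psi>" "bounded_difference (carrier G) \<psi> f"
proof -
  obtain D where D: "\<And>g h. g \<in> carrier G \<Longrightarrow> h \<in> carrier G \<Longrightarrow> \<bar>f g + f h - f (g \<otimes> h)\<bar> \<le> D"
    using assms by (auto simp: quasimorphism_def)
  have "\<exists>L. \<forall>n::nat. \<bar>f (g [^] n) - real n * L\<bar> \<le> D" if "g \<in> carrier G" for g
    using that by (intro almost_additive_slope) (use D in \<open>simp flip: nat_pow_mult\<close>)
  then obtain \<psi> where \<psi>: "\<And>g n. g \<in> carrier G \<Longrightarrow> \<bar>f (g [^] (n::nat)) - real n * \<psi> g\<bar> \<le> D"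
    by metis
  have nat_pow: "\<psi> (g [^] m) = real m * \<psi> g" if g: "g \<in> carrier G" for g and m :: nat
  proof (rule slope_unique; rule bounded_differenceI)
    show "\<bar>f ((g [^] m) [^] n) - real n * \<psi> (g [^] m)\<bar> \<le> D" for n :: nat using \<psi> g by simp
    show "\<bar>f ((g [^] m) [^] n) - real n * (real m * \<psi> g)\<bar> \<le> D" for n :: nat
      using \<psi>[OF g, of "m * n"] g by (simp add: nat_pow_pow mult_ac)
  qed
  have inverse: "\<psi> (inv g) = - \<psi> g" if g: "g \<in> carrier G" for g
  proof (rule slope_unique; rule bounded_differenceI)
    show "\<bar>f (inv g [^] n) - real n * \<psi> (inv g)\<bar> \<le> D" for n :: nat using \<psi> g by simp
    show "\<bar>f (inv g [^] n) - real n * (- \<psi> g)\<bar> \<le> 2 * D + \<bar>f \<one>\<bar>" for n :: nat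
      using D[of "inv (g [^] n)" "g [^] n"] \<psi>[OF g, of n] g by (simp add: nat_pow_inv)
  qed
  show thesis
  proof (rule that)
    have "\<psi> (g [^] n) = of_int n * \<psi> g" if "g \<in> carrier G" for g and n :: int
      by (cases n rule: int_cases2)
        (use that nat_pow inverse in \<open>simp_all add: int_pow_neg int_pow_int\<close>)
    then show "homogeneous G \<psi>" by (simp add: homogeneous_def)
    have "\<bar>\<psi> g - f g\<bar> \<le> D" if "g \<in> carrier G" for g
      using \<psi>[OF that, of 1] that by (simp add: abs_minus_commute)
    then show "bounded_difference (carrier G) \<psi> f" by (rule bounded_differenceI)
  qed
qed

lemma (in group) homogeneous_comp_hom:
  assumes "homogeneous G \<psi>" "\<phi> \<in> hom G G" shows "homogeneous G (\<psi> \<circ> \<phi>)"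
  using assms hom_int_pow[OF assms(2) _ is_group is_group]
  by (auto simp: homogeneous_def hom_in_carrier)

lemma (in group) aut_invariant_homogenization:
  assumes f: "quasimorphism G f"
    and aut: "\<And>\<phi>. \<phi> \<in> iso G G \<Longrightarrow> bounded_difference (carrier G) (f \<circ> \<phi>) f"
  obtains \<psi> where "quasimorphism G \<psi>" "homogeneous G \<psi>" "aut_invariant G \<psi>"
    "bounded_difference (carrier G) \<psi> f"
proof -
  obtain \<psi> where \<psi>: "homogeneous G \<psi>" "bounded_difference (carrier G) \<psi> f"
    using homogenization[OF f] .
  have "\<psi> (\<phi> g) = \<psi> g" if \<phi>: "\<phi> \<in> iso G G" and "g \<in> carrier G" for \<phi> g
  proof -
    have hom: "\<phi> \<in> hom G G" using \<phi> by (simp add: iso_def)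
    then have "bounded_difference (carrier G) (\<psi> \<circ> \<phi>) (f \<circ> \<phi>)"
      by (intro bounded_difference_comp[OF \<psi>(2)]) (auto simp: hom_def)
    also have "bounded_difference (carrier G) (f \<circ> \<phi>) f" using aut \<phi> .
    also have "bounded_difference (carrier G) f \<psi>" using \<psi>(2) by (rule bounded_difference_sym)
    finally show ?thesis
      using homogeneous_unique[OF homogeneous_comp_hom[OF \<psi>(1) hom] \<psi>(1)] that(2) by simp
  qed
  then have "aut_invariant G \<psi>" by (simp add: aut_invariant_def)
  then show thesis using that \<psi> quasimorphism_bounded_difference[OF f] by blast
qed

lemma lin_indep_fun_if_dual:
  assumes "\<And>j. j \<in> I \<Longrightarrow> x j \<in> carrier G"
    and dual: "\<And>i j. i \<in> I \<Longrightarrow> j \<in> I \<Longrightarrow> Q i (x j) \<noteq> 0 \<longleftrightarrow> i = j"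
  shows "lin_indep_fun G Q I"
  unfolding lin_indep_fun_def
proof (intro allI impI ballI, elim conjE)
  fix F c j
  assume F: "finite F" "F \<subseteq> I" "\<forall>g\<in>carrier G. (\<Sum>i\<in>F. c i * Q i g) = 0" and "j \<in> F"
  have off_diagonal: "Q i (x j) = 0" if "i \<in> F - {j}" for i
    using dual[of i j] that F \<open>j \<in> F\<close> by blast
  have "0 = (\<Sum>i\<in>F. c i * Q i (x j))" using F \<open>j \<in> F\<close> assms(1) by auto
  also have "\<dots> = (\<Sum>i\<in>{j}. c i * Q i (x j))"
    using F \<open>j \<in> F\<close> by (intro sum.mono_neutral_right) (auto simp: off_diagonal)
  finally show "c j = 0" using F \<open>j \<in> F\<close> dual[of j j] by auto
qed

section \<open>Words\<close>

definition inv_letter :: "'v \<times> bool \<Rightarrow> 'v \<times> bool" where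
  "inv_letter z = (fst z, \<not> snd z)"

definition inv_word :: "('v \<times> bool) list \<Rightarrow> ('v \<times> bool) list" where
  "inv_word w = rev (map inv_letter w)"

definition retraction :: "'v set \<Rightarrow> ('v \<times> bool) list \<Rightarrow> ('v \<times> bool) list" where
  "retraction S w = filter (\<lambda>z. fst z \<in> S) w"

definition word_power :: "'a list \<Rightarrow> nat \<Rightarrow> 'a list" where
  "word_power w n = concat (replicate n w)"

definition exponent :: "'v \<Rightarrow> 'v \<times> bool \<Rightarrow> int" where
  "exponent v z = (if fst z = v then (if snd z then 1 else - 1) else 0)"

definition exponent_sum :: "'v \<Rightarrow> ('v \<times> bool) list \<Rightarrow> int" where
  "exponent_sum v w = sum_list (map (exponent v) w)"

lemma inv_letter_inv_letter [simp]: "inv_letter (inv_letter z) = z"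
  by (simp add: inv_letter_def)

lemma fst_inv_letter [simp]: "fst (inv_letter z) = fst z"
  by (simp add: inv_letter_def)

lemma inv_letter_neq [simp]: "inv_letter z \<noteq> z" "z \<noteq> inv_letter z"
  by (cases z; simp add: inv_letter_def)+

lemma inv_letter_eq_iff [simp]: "inv_letter y = inv_letter z \<longleftrightarrow> y = z"
  by (metis inv_letter_inv_letter)

lemma eq_or_inv_letter: "fst y = fst z \<Longrightarrow> y = z \<or> y = inv_letter z"
  by (cases y; cases z) (auto simp: inv_letter_def)

lemma inv_word_Nil [simp]: "inv_word [] = []"
  and inv_word_Cons: "inv_word (z # w) = inv_word w @ [inv_letter z]"
  and inv_word_append [simp]: "inv_word (a @ b) = inv_word b @ inv_word a"
  and inv_word_inv_word [simp]: "inv_word (inv_word w) = w"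
  and length_inv_word [simp]: "length (inv_word w) = length w"
  and inv_word_single [simp]: "inv_word [z] = [inv_letter z]"
  and inv_word_eq_Nil_iff [simp]: "inv_word w = [] \<longleftrightarrow> w = []"
  and set_inv_word: "set (inv_word w) = inv_letter ` set w"
  by (simp_all add: inv_word_def rev_map comp_def)

lemma fst_hd_inv_word: "w \<noteq> [] \<Longrightarrow> fst (hd (inv_word w)) = fst (last w)"
  by (simp add: inv_word_def hd_rev last_map)

lemma last_inv_word: "w \<noteq> [] \<Longrightarrow> last (inv_word w) = inv_letter (hd w)"
  by (simp add: inv_word_def last_rev hd_map)

lemma retraction_simps [simp]:
  "retraction S [] = []" "retraction S (a @ b) = retraction S a @ retraction S b"
  "retraction S (z # w) = (if fst z \<in> S then z # retraction S w else retraction S w)"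
  by (simp_all add: retraction_def)

lemma retraction_retraction [simp]: "retraction S (retraction T w) = retraction (S \<inter> T) w"
  by (simp add: retraction_def conj_commute)

lemma retraction_UNIV [simp]: "retraction UNIV w = w"
  by (simp add: retraction_def)

lemma retraction_inv_word: "retraction S (inv_word w) = inv_word (retraction S w)"
  by (induction w) (simp_all add: inv_word_Cons)

lemma set_retraction: "set (retraction S w) = {z \<in> set w. fst z \<in> S}"
  by (simp add: retraction_def)

lemma word_power_0 [simp]: "word_power w 0 = []"
  and word_power_Suc [simp]: "word_power w (Suc n) = w @ word_power w n"
  by (simp_all add: word_power_def)

lemma word_power_Suc_right: "word_power w (Suc n) = word_power w n @ w"
  by (induction n) simp_all

lemma set_word_power: "set (word_power w n) \<subseteq> set w"
  by (auto simp: word_power_def)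

lemma exponent_inv_letter [simp]: "exponent v (inv_letter z) = - exponent v z"
  by (simp add: exponent_def inv_letter_def)

lemma abs_exponent_le: "\<bar>exponent v z\<bar> \<le> 1"
  by (simp add: exponent_def)

lemma exponent_sum_simps [simp]:
  "exponent_sum v [] = 0" "exponent_sum v (z # w) = exponent v z + exponent_sum v w"
  "exponent_sum v (a @ b) = exponent_sum v a + exponent_sum v b"
  by (simp_all add: exponent_sum_def)

lemma exponent_sum_inv_word [simp]: "exponent_sum v (inv_word w) = - exponent_sum v w"
  by (induction w) (simp_all add: inv_word_Cons)

lemma exponent_sum_retraction: "v \<in> S \<Longrightarrow> exponent_sum v (retraction S w) = exponent_sum v w"
  by (induction w) (auto simp: exponent_def)

lemma exponent_sum_word_power [simp]: "exponent_sum v (word_power w n) = int n * exponent_sum v w"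
  by (induction n) (simp_all add: algebra_simps)

lemma exponent_sum_replicate [simp]: "exponent_sum v (replicate n z) = int n * exponent v z"
  by (induction n) (simp_all add: algebra_simps)

lemma raag_words_iff: "w \<in> raag_words S \<longleftrightarrow> fst ` set w \<subseteq> S"
  by (auto simp: raag_words_def lists_eq_set mem_Times_iff)

lemma raag_words_simps [simp]:
  "[] \<in> raag_words S" "z # w \<in> raag_words S \<longleftrightarrow> fst z \<in> S \<and> w \<in> raag_words S"
  "a @ b \<in> raag_words S \<longleftrightarrow> a \<in> raag_words S \<and> b \<in> raag_words S"
  by (auto simp: raag_words_iff)

lemma inv_word_in_raag_words [simp]: "inv_word w \<in> raag_words S \<longleftrightarrow> w \<in> raag_words S"
  by (simp add: raag_words_iff set_inv_word image_image)

lemma word_power_in_raag_words: "w \<in> raag_words S \<Longrightarrow> word_power w n \<in> raag_words S"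
  by (induction n) simp_all

lemma retraction_in_raag_words [simp]: "retraction S w \<in> raag_words S"
  "w \<in> raag_words T \<Longrightarrow> retraction S w \<in> raag_words T"
  by (auto simp: raag_words_iff set_retraction)

lemma retraction_id: "w \<in> raag_words S \<Longrightarrow> retraction S w = w"
  by (induction w) simp_all

lemma exponent_sum_eq_0: "w \<in> raag_words S \<Longrightarrow> v \<notin> S \<Longrightarrow> exponent_sum v w = 0"
  by (induction w) (auto simp: exponent_def)

section \<open>Free reduction\<close>

fun reduced :: "('v \<times> bool) list \<Rightarrow> bool" where
  "reduced (z # y # w) \<longleftrightarrow> y \<noteq> inv_letter z \<and> reduced (y # w)"
| "reduced _ \<longleftrightarrow> True"

fun cons_reduce :: "'v \<times> bool \<Rightarrow> ('v \<times> bool) list \<Rightarrow> ('v \<times> bool) list" where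
  "cons_reduce z [] = [z]"
| "cons_reduce z (y # w) = (if y = inv_letter z then w else z # y # w)"

definition nf :: "('v \<times> bool) list \<Rightarrow> ('v \<times> bool) list" where
  "nf w = foldr cons_reduce w []"

lemma nf_simps [simp]: "nf [] = []" "nf (z # w) = cons_reduce z (nf w)"
  by (simp_all add: nf_def)

lemma reduced_Cons: "reduced (z # w) \<longleftrightarrow> reduced w \<and> (w = [] \<or> hd w \<noteq> inv_letter z)"
  by (cases w) auto

lemma reduced_append:
  "reduced (a @ b) \<longleftrightarrow> reduced a \<and> reduced b \<and> (a = [] \<or> b = [] \<or> hd b \<noteq> inv_letter (last a))"
  by (induction a) (auto simp: reduced_Cons hd_append)

lemma reduced_inv_word: "reduced w \<Longrightarrow> reduced (inv_word w)"
  by (induction w) (auto simp: reduced_Cons inv_word_Cons reduced_append last_inv_word)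

lemma reduced_if_no_inverse_letters:
  "(\<And>z. z \<in> set w \<Longrightarrow> inv_letter z \<notin> set w) \<Longrightarrow> reduced w"
  by (induction w) (auto simp: reduced_Cons dest: hd_in_set)

lemma cons_reduce_eq_Cons: "reduced (z # w) \<Longrightarrow> cons_reduce z w = z # w"
  by (cases w) auto

lemma reduced_cons_reduce: "reduced w \<Longrightarrow> reduced (cons_reduce z w)"
  by (cases w) (auto simp: reduced_Cons)

lemma reduced_nf [simp]: "reduced (nf w)"
  by (induction w) (auto intro: reduced_cons_reduce)

lemma nf_reduced: "reduced w \<Longrightarrow> nf w = w"
  by (induction w) (auto simp: reduced_Cons cons_reduce_eq_Cons)

lemma nf_nf [simp]: "nf (nf w) = nf w"
  by (simp add: nf_reduced)

lemma cons_reduce_cancel [simp]: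
  assumes "reduced w" shows "cons_reduce z (cons_reduce (inv_letter z) w) = w"
proof (cases w)
  case (Cons y v)
  then show ?thesis using assms by (cases "y = z") (auto simp: cons_reduce_eq_Cons)
qed simp

lemma foldr_cons_reduce_nf:
  assumes "reduced r" shows "foldr cons_reduce (nf a) r = foldr cons_reduce a r"
proof -
  have reduced_foldr: "reduced (foldr cons_reduce u r)" for u
    using assms by (induction u) (auto intro: reduced_cons_reduce)
  have "foldr cons_reduce (cons_reduce z v) r = cons_reduce z (foldr cons_reduce v r)" for z v
    by (cases v) (auto simp: reduced_foldr)
  then show ?thesis by (induction a) simp_all
qed

lemma nf_append_cong:
  assumes "nf a = nf a'" "nf b = nf b'" shows "nf (a @ b) = nf (a' @ b')"
proof -
  have "nf (c @ d) = foldr cons_reduce (nf c) (nf d)" for c d :: "('a \<times> bool) list"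
    using foldr_cons_reduce_nf[OF reduced_nf, of c d] by (simp add: nf_def)
  then show ?thesis using assms by simp
qed

lemma nf_context: "nf a = nf a' \<Longrightarrow> nf (p @ a @ q) = nf (p @ a' @ q)"
  by (intro nf_append_cong refl)

lemma nf_append_inv_word: "nf (w @ inv_word w) = []"
proof (induction w)
  case (Cons z w)
  have "nf ([z] @ (w @ inv_word w) @ [inv_letter z]) = nf ([z] @ [] @ [inv_letter z])"
    using Cons by (intro nf_context) simp
  then show ?case by (simp add: inv_word_Cons)
qed simp

lemma nf_cancel:
  "nf (p @ w @ inv_word w @ q) = nf (p @ q)" "nf (p @ inv_word w @ w @ q) = nf (p @ q)"
  using nf_context[of "w @ inv_word w" "[]" p q] nf_context[of "inv_word w @ w" "[]" p q]
    nf_append_inv_word[of w] nf_append_inv_word[of "inv_word w"] by simp_all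

lemma nf_inv_word: "nf (inv_word w) = inv_word (nf w)"
proof -
  have "nf (inv_word w) = nf (inv_word w @ nf w @ inv_word (nf w))"
    using nf_cancel(1)[of "inv_word w" "nf w" "[]"] by simp
  also have "\<dots> = nf (inv_word w @ w @ inv_word (nf w))" by (intro nf_context) simp
  also have "\<dots> = nf (inv_word (nf w))" using nf_cancel(2)[of "[]"] by simp
  also have "\<dots> = inv_word (nf w)" by (simp add: nf_reduced reduced_inv_word)
  finally show ?thesis .
qed

lemma set_nf: "set (nf w) \<subseteq> set w"
proof (induction w)
  case (Cons z w)
  have "set (cons_reduce z r) \<subseteq> insert z (set r)" for r by (cases r) auto
  then show ?case using Cons by fastforce
qed simp

lemma nf_in_raag_words: "w \<in> raag_words S \<Longrightarrow> nf w \<in> raag_words S"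
  using set_nf[of w] by (auto simp: raag_words_iff)

lemma nf_map:
  assumes "inj_on \<rho> (S \<times> UNIV)" "\<And>z. \<rho> (inv_letter z) = inv_letter (\<rho> z)" "w \<in> raag_words S"
  shows "nf (map \<rho> w) = map \<rho> (nf w)"
  using assms(3)
proof (induction w)
  case (Cons z w)
  have "cons_reduce (\<rho> z) (map \<rho> r) = map \<rho> (cons_reduce z r)" if "r \<in> raag_words S" for r
  proof (cases r)
    case (Cons y u)
    then have "\<rho> y = inv_letter (\<rho> z) \<longleftrightarrow> y = inv_letter z"
      using inj_on_eq_iff[OF assms(1), of y "inv_letter z"] assms(2) Cons.prems that
      by (simp add: mem_Times_iff)
    then show ?thesis using Cons by simp
  qed simp
  then show ?case using Cons nf_in_raag_words by auto
qed simp

lemma nf_concat_map_nf: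
  assumes "\<And>z. nf (\<tau> (inv_letter z)) = nf (inv_word (\<tau> z))"
  shows "nf (concat (map \<tau> (nf w))) = nf (concat (map \<tau> w))"
proof (induction w)
  case (Cons z w)
  have "nf (concat (map \<tau> (cons_reduce z r))) = nf (\<tau> z @ concat (map \<tau> r))" for r
  proof (cases r)
    case (Cons y u)
    have "nf (concat (map \<tau> u)) = nf (\<tau> z @ \<tau> (inv_letter z) @ concat (map \<tau> u))"
      using nf_context[OF assms[of z], of "\<tau> z"] nf_cancel(1)[of "[]" "\<tau> z"] by simp
    then show ?thesis using Cons by simp
  qed simp
  also have "nf (\<tau> z @ concat (map \<tau> (nf w))) = nf (\<tau> z @ concat (map \<tau> w))"
    using Cons by (intro nf_append_cong refl)
  finally show ?case by simp
qed simp

lemma reduced_product_cancellation: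
  assumes "reduced r" "reduced s"
  obtains a b c where "r = a @ c" "s = inv_word c @ b" "reduced (a @ b)"
proof -
  have "\<exists>a b c. r = a @ c \<and> s = inv_word c @ b \<and> reduced (a @ b)"
    using assms
  proof (induction r arbitrary: s rule: rev_induct)
    case (snoc z r)
    show ?case
    proof (cases "s \<noteq> [] \<and> hd s = inv_letter z")
      case True
      then obtain s' where s: "s = inv_letter z # s'" by (cases s) auto
      then obtain a b c where "r = a @ c" "s' = inv_word c @ b" "reduced (a @ b)"
        using snoc by (metis reduced_append reduced_Cons)
      then have "r @ [z] = a @ (c @ [z])" "s = inv_word (c @ [z]) @ b" "reduced (a @ b)"
        using s by simp_all
      then show ?thesis by blast
    next
      case False
      then have "reduced ((r @ [z]) @ s)"
        using snoc.prems by (auto simp: reduced_append reduced_Cons)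
      moreover have "r @ [z] = (r @ [z]) @ []" "s = inv_word [] @ s" by simp_all
      ultimately show ?thesis by blast
    qed
  qed auto
  then show ?thesis using that by blast
qed

lemma reduced_single_generator:
  assumes "reduced w" "w \<in> raag_words {x}"
  shows "\<exists>b. w = replicate (length w) (x, b)"
  using assms
proof (induction w)
  case (Cons z w)
  then obtain b where w: "w = replicate (length w) (x, b)" by (auto simp: reduced_Cons)
  obtain e where z: "z = (x, e)" using Cons.prems by (cases z) auto
  show ?case
  proof (cases "w = []")
    case False
    then have "hd w = (x, b)" using w by (metis hd_replicate length_0_conv)
    then have "e = b" using Cons.prems z False by (auto simp: reduced_Cons inv_letter_def)
    then show ?thesis using w z by auto
  qed (use z in auto)
qed simp

section \<open>Conjugates of generators that generate a free group of rank two\<close>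

definition conj_letter :: "('v \<Rightarrow> ('v \<times> bool) list) \<Rightarrow> 'v \<times> bool \<Rightarrow> ('v \<times> bool) list" where
  "conj_letter \<kappa> z = \<kappa> (fst z) @ [z] @ inv_word (\<kappa> (fst z))"

lemma conj_letter_inv_letter: "conj_letter \<kappa> (inv_letter z) = inv_word (conj_letter \<kappa> z)"
  by (simp add: conj_letter_def inv_word_Cons)

lemma nf_concat_map_conj:
  assumes "\<And>z. z \<in> set w \<Longrightarrow> nf (\<sigma> z) = nf (k @ \<tau> z @ inv_word k)"
  shows "nf (concat (map \<sigma> w)) = nf (k @ concat (map \<tau> w) @ inv_word k)"
  using assms
proof (induction w)
  case Nil
  then show ?case by (simp add: nf_append_inv_word)
next
  case (Cons z w)
  have "nf (concat (map \<sigma> (z # w)))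
      = nf ((k @ \<tau> z @ inv_word k) @ (k @ concat (map \<tau> w) @ inv_word k))"
    unfolding list.map concat.simps using Cons by (intro nf_append_cong) auto
  also have "\<dots> = nf (k @ concat (map \<tau> (z # w)) @ inv_word k)"
    using nf_cancel(2)[of "k @ \<tau> z" k "concat (map \<tau> w) @ inv_word k"] by simp
  finally show ?case .
qed

lemma nf_conj_own_power:
  assumes "p \<in> raag_words {fst z}"
  shows "nf (p @ [z] @ inv_word p) = [z]"
proof -
  have "nf (p @ [z]) = nf ([z] @ p)"
    using assms
  proof (induction p)
    case (Cons y p)
    then have "fst y = fst z" by simp
    then consider (same) "y = z" | (inverse) "y = inv_letter z" using eq_or_inv_letter by blast
    then show ?case
    proof cases
      case inverse
      moreover have "cons_reduce (inv_letter z) (cons_reduce z (nf p)) = nf p"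
        using cons_reduce_cancel[of "nf p" "inv_letter z"] by simp
      ultimately show ?thesis using Cons by auto
    qed (use Cons in auto)
  qed simp
  then have "nf ((p @ [z]) @ inv_word p) = nf (([z] @ p) @ inv_word p)"
    by (rule nf_append_cong) simp
  then show ?thesis using nf_cancel(1)[of "[z]" p "[]"] by simp
qed

lemma nf_conj_append_own_power:
  assumes "p \<in> raag_words {fst z}"
  shows "nf ((a @ p) @ [z] @ inv_word (a @ p)) = nf (a @ [z] @ inv_word a)"
  using nf_context[of "p @ [z] @ inv_word p" "[z]" a "inv_word a"] nf_conj_own_power[OF assms]
  by simp

lemma strip_outer_powers:
  assumes "w \<in> raag_words {x, y}"
  obtains p d q where "w = p @ d @ q" "p \<in> raag_words {x}" "q \<in> raag_words {y}"
    "d \<noteq> [] \<Longrightarrow> fst (hd d) = y \<and> fst (last d) = x"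
proof
  let ?P = "\<lambda>z. fst z = x" and ?Q = "\<lambda>z. fst z = y"
  define e where "e = dropWhile ?P w"
  define d where "d = rev (dropWhile ?Q (rev e))"
  have e: "e = d @ rev (takeWhile ?Q (rev e))"
    unfolding d_def by (metis rev_append rev_rev_ident takeWhile_dropWhile_id)
  show w: "w = takeWhile ?P w @ d @ rev (takeWhile ?Q (rev e))"
    using e takeWhile_dropWhile_id[of ?P w] by (simp add: e_def)
  show "takeWhile ?P w \<in> raag_words {x}" "rev (takeWhile ?Q (rev e)) \<in> raag_words {y}"
    by (auto simp: raag_words_iff dest: set_takeWhileD)
  assume d: "d \<noteq> []"
  then have "e \<noteq> []" "hd d = hd e" using e by (auto, metis hd_append2)
  then have "fst (hd d) \<noteq> x" using hd_dropWhile[of ?P w] by (simp add: e_def)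
  moreover have "fst (last d) \<noteq> y"
    using d hd_dropWhile[of ?Q "rev e"] by (simp add: d_def last_rev)
  moreover have "hd d \<in> set w" "last d \<in> set w"
    using d w by (metis Un_iff hd_in_set set_append, metis Un_iff last_in_set set_append)
  then have "fst (hd d) \<in> {x, y}" "fst (last d) \<in> {x, y}"
    using assms unfolding raag_words_iff by blast+
  ultimately show "fst (hd d) = y \<and> fst (last d) = x" by auto
qed

definition conj_start ::
  "'v \<Rightarrow> ('v \<times> bool) list \<Rightarrow> 'v \<times> bool \<Rightarrow> ('v \<times> bool) list" where
  "conj_start x c z = (if fst z = x then [z] else c @ [z])"

context
  fixes x y :: 'v and c :: "('v \<times> bool) list" and \<tau> :: "'v \<times> bool \<Rightarrow> ('v \<times> bool) list"
  assumes distinct: "x \<noteq> y"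
    and conjugator: "reduced c" "c \<noteq> []" "fst (hd c) = y" "fst (last c) = x"
  defines "\<tau> \<equiv> conj_letter ((\<lambda>_. c)(x := []))"
begin

text \<open>The leading \<open>c\<close> of an image survives free reduction: the only cancellations are those of
  \<open>c\<^sup>-\<^sup>1 c\<close> between adjacent occurrences of the same letter over \<open>y\<close>.\<close>

lemma reduced_conj_append:
  assumes z: "fst z = y" and r: "reduced r" "r = [] \<or> fst (hd r) = x"
  shows "reduced (c @ [z])" "reduced ((c @ [z]) @ inv_word c @ r)"
proof -
  show cz: "reduced (c @ [z])"
    using conjugator distinct z by (auto simp: reduced_append dest: arg_cong[where f = fst])
  have "fst (hd (inv_word c)) = x" "last (inv_word c) = inv_letter (hd c)"
    using conjugator fst_hd_inv_word last_inv_word by auto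
  then show "reduced ((c @ [z]) @ inv_word c @ r)"
    using cz reduced_inv_word[OF conjugator(1)] r conjugator distinct z
    by (auto simp: reduced_append reduced_Cons hd_append dest: arg_cong[where f = fst])
qed

lemma conj_start_prefix_cases:
  assumes "fst z = y" "fst z' \<in> {x, y}" "z' \<noteq> inv_letter z" "prefix (conj_start x c z') r"
  shows "fst (hd r) = x \<or> (\<exists>u. r = c @ z # u)"
proof (cases "fst z' = x")
  case False
  then have "z' = z" using assms eq_or_inv_letter[of z' z] by auto
  then show ?thesis using assms(4) False by (auto simp: conj_start_def prefix_def)
qed (use assms(4) in \<open>auto simp: conj_start_def prefix_def\<close>)

lemma conj_start_prefix_nf:
  assumes z: "fst z \<in> {x, y}" and "reduced r"
    and r: "r = [] \<or> (\<exists>z'. fst z' \<in> {x, y} \<and> z' \<noteq> inv_letter z \<and> prefix (conj_start x c z') r)"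
  shows "prefix (conj_start x c z) (nf (\<tau> z @ r))"
proof (cases "fst z = x")
  case True
  have "r = [] \<or> hd r \<noteq> inv_letter z"
    using r conjugator True distinct
    by (auto simp: conj_start_def prefix_def hd_append dest: arg_cong[where f = fst])
  then have "reduced (z # r)" using \<open>reduced r\<close> by (auto simp: reduced_Cons)
  then have "nf (\<tau> z @ r) = z # r"
    using True nf_reduced[of "z # r"] by (simp add: \<tau>_def conj_letter_def)
  then show ?thesis using True by (simp add: conj_start_def)
next
  case False
  then have over_y: "fst z = y" using z by simp
  then have \<tau>_z: "\<tau> z = c @ [z] @ inv_word c" using distinct by (simp add: \<tau>_def conj_letter_def)
  consider (no_cancellation) "r = [] \<or> fst (hd r) = x" | (same_letter) u where "r = c @ z # u"
    using r conj_start_prefix_cases[OF over_y] by blast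
  then have "\<exists>v. nf (\<tau> z @ r) = (c @ [z]) @ v"
  proof cases
    case no_cancellation
    then have "reduced ((c @ [z]) @ inv_word c @ r)"
      using reduced_conj_append(2)[OF over_y] \<open>reduced r\<close> by blast
    then have "nf (\<tau> z @ r) = (c @ [z]) @ inv_word c @ r" using nf_reduced by (simp add: \<tau>_z)
    then show ?thesis by blast
  next
    case (same_letter u)
    then have "reduced ((c @ [z]) @ z # u)"
      using reduced_conj_append(1)[OF over_y, of "[]"] \<open>reduced r\<close> by (auto simp: reduced_append)
    moreover have "nf (\<tau> z @ r) = nf ((c @ [z]) @ z # u)"
      using nf_cancel(2)[of "c @ [z]" c "z # u"] by (simp add: \<tau>_z same_letter)
    ultimately show ?thesis using nf_reduced by metis
  qed
  then show ?thesis using False by (auto simp: conj_start_def)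
qed

lemma conj_start_prefix_nf_substitution:
  assumes "reduced w" "w \<in> raag_words {x, y}" "w \<noteq> []"
  shows "prefix (conj_start x c (hd w)) (nf (concat (map \<tau> w)))"
  using assms
proof (induction w)
  case (Cons z w)
  let ?r = "nf (concat (map \<tau> w))"
  have "?r = [] \<or> (\<exists>z'. fst z' \<in> {x, y} \<and> z' \<noteq> inv_letter z \<and> prefix (conj_start x c z') ?r)"
  proof (cases w)
    case w: (Cons z' w')
    then have "prefix (conj_start x c z') ?r" using Cons by (simp add: reduced_Cons)
    moreover have "fst z' \<in> {x, y}" "z' \<noteq> inv_letter z"
      using w Cons.prems by (simp_all add: reduced_Cons)
    ultimately show ?thesis by blast
  qed simp
  then have "prefix (conj_start x c z) (nf (\<tau> z @ ?r))"
    using Cons.prems by (intro conj_start_prefix_nf) auto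
  moreover have "nf (\<tau> z @ ?r) = nf (concat (map \<tau> (z # w)))"
    using nf_append_cong[of "\<tau> z" "\<tau> z" ?r "concat (map \<tau> w)"] by simp
  ultimately show ?case by simp
qed simp

lemma nf_conj_substitution_neq_generator:
  assumes "w \<in> raag_words {x, y}" shows "nf (concat (map \<tau> w)) \<noteq> [(y, b)]"
proof -
  have "nf (concat (map \<tau> (nf w))) \<noteq> [(y, b)]"
  proof (cases "nf w = []")
    case False
    then have "prefix (conj_start x c (hd (nf w))) (nf (concat (map \<tau> (nf w))))"
      using assms by (intro conj_start_prefix_nf_substitution nf_in_raag_words) auto
    then show ?thesis
      using distinct conjugator(2)
      by (auto simp: conj_start_def prefix_Cons append_eq_Cons_conv split: if_splits)
  qed simp
  then show ?thesis
    using nf_concat_map_nf[of \<tau> w] by (simp add: \<tau>_def conj_letter_inv_letter)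
qed

end

lemma common_conjugator:
  fixes \<kappa> :: "'v \<Rightarrow> ('v \<times> bool) list"
  assumes \<kappa>: "\<kappa> x \<in> raag_words {x, y}" "\<kappa> y \<in> raag_words {x, y}"
  obtains k d where "k \<in> raag_words {x, y}" "reduced d"
    "d \<noteq> [] \<Longrightarrow> fst (hd d) = y \<and> fst (last d) = x"
    "\<And>z. fst z \<in> {x, y} \<Longrightarrow>
       nf (conj_letter \<kappa> z) = nf (k @ conj_letter ((\<lambda>_. d)(x := [])) z @ inv_word k)"
proof -
  define c where "c = nf (inv_word (\<kappa> x) @ \<kappa> y)"
  have reduced_c: "reduced c" and c_words: "c \<in> raag_words {x, y}"
    using \<kappa> by (auto simp: c_def intro!: nf_in_raag_words)
  obtain p d q where split: "c = p @ d @ q" "p \<in> raag_words {x}" "q \<in> raag_words {y}"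
    and d_ends: "d \<noteq> [] \<Longrightarrow> fst (hd d) = y \<and> fst (last d) = x"
    using strip_outer_powers[OF c_words] by blast
  show thesis
  proof (rule that[of "\<kappa> x @ p" d])
    show "\<kappa> x @ p \<in> raag_words {x, y}" "reduced d"
      using \<kappa> reduced_c split by (auto simp: raag_words_iff reduced_append)
    show "fst (hd d) = y \<and> fst (last d) = x" if "d \<noteq> []" using d_ends that .
    show "nf (conj_letter \<kappa> z)
        = nf ((\<kappa> x @ p) @ conj_letter ((\<lambda>_. d)(x := [])) z @ inv_word (\<kappa> x @ p))"
      if z: "fst z \<in> {x, y}" for z
    proof (cases "fst z = x")
      case True
      then show ?thesis
        using nf_conj_append_own_power[of p z "\<kappa> x"] split(2) by (simp add: conj_letter_def)
    next
      case False
      have "nf (\<kappa> x @ c) = nf (\<kappa> x @ inv_word (\<kappa> x) @ \<kappa> y)"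
        unfolding c_def by (intro nf_append_cong) simp_all
      then have \<kappa>y: "nf (\<kappa> y) = nf (\<kappa> x @ c)" using nf_cancel(1)[of "[]" "\<kappa> x" "\<kappa> y"] by simp
      have "nf (\<kappa> y @ [z] @ inv_word (\<kappa> y)) = nf ((\<kappa> x @ c) @ [z] @ inv_word (\<kappa> x @ c))"
        by (intro nf_append_cong refl) (simp_all only: \<kappa>y nf_inv_word)
      also have "\<dots> = nf ((\<kappa> x @ p @ d) @ [z] @ inv_word (\<kappa> x @ p @ d))"
        using nf_conj_append_own_power[of q z "\<kappa> x @ p @ d"] split z False by auto
      finally show ?thesis using False z by (auto simp: conj_letter_def)
    qed
  qed
qed

lemma inner_if_conj_letters_generate:
  fixes \<kappa> :: "'v \<Rightarrow> ('v \<times> bool) list"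
  assumes distinct: "x \<noteq> y" and \<kappa>: "\<kappa> x \<in> raag_words {x, y}" "\<kappa> y \<in> raag_words {x, y}"
    and generate: "\<And>v. v \<in> raag_words {x, y} \<Longrightarrow>
                     \<exists>w \<in> raag_words {x, y}. nf (concat (map (conj_letter \<kappa>) w)) = nf v"
  shows "\<exists>k. \<forall>z. fst z \<in> {x, y} \<longrightarrow> nf (conj_letter \<kappa> z) = nf (k @ [z] @ inv_word k)"
proof -
  obtain k d where k_words: "k \<in> raag_words {x, y}"
    and reduced_d: "reduced d" and d_ends: "d \<noteq> [] \<Longrightarrow> fst (hd d) = y \<and> fst (last d) = x"
    and conj: "\<And>z. fst z \<in> {x, y} \<Longrightarrow>
      nf (conj_letter \<kappa> z) = nf (k @ conj_letter ((\<lambda>_. d)(x := [])) z @ inv_word k)"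
    using common_conjugator[OF \<kappa>] by metis
  let ?\<tau> = "conj_letter ((\<lambda>_. d)(x := []))"
  have "d = []"
  proof (rule ccontr)
    assume "d \<noteq> []"
    obtain w where w: "w \<in> raag_words {x, y}"
      "nf (concat (map (conj_letter \<kappa>) w)) = nf (k @ [(y, True)] @ inv_word k)"
      using generate[of "k @ [(y, True)] @ inv_word k"] k_words by auto
    have "nf (k @ concat (map ?\<tau> w) @ inv_word k) = nf (k @ [(y, True)] @ inv_word k)"
      using nf_concat_map_conj[of w "conj_letter \<kappa>" k ?\<tau>] conj w by (fastforce simp: raag_words_iff)
    from nf_context[OF this, of "inv_word k" k] have "nf (concat (map ?\<tau> w)) = [(y, True)]"
      using nf_cancel(2)[of "[]" k] nf_cancel(2)[of "concat (map ?\<tau> w)" k "[]"]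
        nf_cancel(2)[of "[(y, True)]" k "[]"] by simp
    then show False
      using nf_conj_substitution_neq_generator[OF distinct reduced_d \<open>d \<noteq> []\<close> _ _ w(1)]
        d_ends \<open>d \<noteq> []\<close> by blast
  qed
  then have "?\<tau> z = [z]" for z by (simp add: conj_letter_def)
  then show ?thesis using conj by auto
qed

section \<open>Counting occurrences of a word\<close>

definition occurrences :: "'a list \<Rightarrow> 'a list \<Rightarrow> nat set" where
  "occurrences u w = {i. i + length u \<le> length w \<and> take (length u) (drop i w) = u}"

definition occurrence_count :: "'a list \<Rightarrow> 'a list \<Rightarrow> nat" where
  "occurrence_count u w = card (occurrences u w)"

lemma finite_occurrences [simp]: "finite (occurrences u w)"
  by (rule finite_subset[of _ "{..length w}"]) (auto simp: occurrences_def)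

lemma occurrences_eq_empty_iff: "occurrences u w = {} \<longleftrightarrow> \<not> sublist u w"
proof
  have "length p \<in> occurrences u (p @ u @ q)" for p q by (simp add: occurrences_def)
  then show "occurrences u w = {} \<Longrightarrow> \<not> sublist u w" by (auto simp: sublist_def)
  have "w = take i w @ u @ drop (i + length u) w" if "i \<in> occurrences u w" for i
    using that append_take_drop_id[of "length u" "drop i w"]
    by (simp add: occurrences_def add.commute)
  then show "\<not> sublist u w \<Longrightarrow> occurrences u w = {}" by (metis sublist_def equals0I)
qed

lemma occurrence_count_eq_0_iff: "occurrence_count u w = 0 \<longleftrightarrow> \<not> sublist u w"
  by (simp add: occurrence_count_def occurrences_eq_empty_iff)

lemma occurrence_count_append_ge:
  assumes "u \<noteq> []"
  shows "occurrence_count u a + occurrence_count u b \<le> occurrence_count u (a @ b)"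
proof -
  let ?shift = "(+) (length a)"
  have "occurrences u a \<inter> ?shift ` occurrences u b = {}"
    using assms by (auto simp: occurrences_def)
  then have "occurrence_count u a + occurrence_count u b
      = card (occurrences u a \<union> ?shift ` occurrences u b)"
    by (simp add: occurrence_count_def card_image card_Un_disjoint)
  also have "\<dots> \<le> occurrence_count u (a @ b)"
    unfolding occurrence_count_def
    by (intro card_mono finite_occurrences) (auto simp: occurrences_def)
  finally show ?thesis .
qed

lemma occurrence_count_append_le:
  "occurrence_count u (a @ b) \<le> occurrence_count u a + occurrence_count u b + length u"
proof -
  let ?shift = "(+) (length a)"
  let ?straddling = "{length a - length u..<length a}"
  have "occurrences u (a @ b) \<subseteq> (occurrences u a \<union> ?shift ` occurrences u b) \<union> ?straddling"
  proof
    fix i assume i: "i \<in> occurrences u (a @ b)"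
    consider (left) "i + length u \<le> length a" | (right) "length a \<le> i"
      | (straddling) "i \<in> ?straddling" by fastforce
    then show "i \<in> (occurrences u a \<union> ?shift ` occurrences u b) \<union> ?straddling"
    proof cases
      case left
      then have "i \<in> occurrences u a" using i by (simp add: occurrences_def)
      then show ?thesis by blast
    next
      case right
      then have "i - length a \<in> occurrences u b" using i by (auto simp: occurrences_def)
      then show ?thesis using right by (auto intro!: image_eqI[of _ _ "i - length a"])
    qed blast
  qed
  then have "occurrence_count u (a @ b)
      \<le> card ((occurrences u a \<union> ?shift ` occurrences u b) \<union> ?straddling)"
    unfolding occurrence_count_def by (intro card_mono) auto
  also have "\<dots> \<le> (card (occurrences u a) + card (?shift ` occurrences u b)) + card ?straddling"
    by (intro order.trans[OF card_Un_le] add_right_mono card_Un_le)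
  also have "\<dots> \<le> occurrence_count u a + occurrence_count u b + length u"
    by (simp add: occurrence_count_def card_image)
  finally show ?thesis .
qed

lemma occurrence_count_rev_le: "occurrence_count u w \<le> occurrence_count (rev u) (rev w)"
  unfolding occurrence_count_def
proof (rule card_inj_on_le[where f = "\<lambda>i. length w - length u - i"])
  show "inj_on (\<lambda>i. length w - length u - i) (occurrences u w)"
    by (auto simp: inj_on_def occurrences_def)
  show "(\<lambda>i. length w - length u - i) ` occurrences u w \<subseteq> occurrences (rev u) (rev w)"
    by (auto simp: occurrences_def drop_rev take_rev drop_take)
qed simp

lemma occurrence_count_rev: "occurrence_count (rev u) (rev w) = occurrence_count u w"
  using occurrence_count_rev_le[of u w] occurrence_count_rev_le[of "rev u" "rev w"] by simp

lemma occurrence_count_map: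
  assumes "inj_on f A" "set u \<subseteq> A" "set w \<subseteq> A"
  shows "occurrence_count (map f u) (map f w) = occurrence_count u w"
proof -
  have "map f v = map f u \<longleftrightarrow> v = u" if "set v \<subseteq> set w" for v
    using that assms by (intro inj_on_map_eq_map) (auto intro: inj_on_subset)
  moreover have "set (take m (drop i w)) \<subseteq> set w" for m i
    by (meson set_take_subset set_drop_subset subset_trans)
  ultimately have "occurrences (map f u) (map f w) = occurrences u w"
    by (simp add: occurrences_def take_map drop_map)
  then show ?thesis by (simp add: occurrence_count_def)
qed

section \<open>Brooks counting functions\<close>

definition brooks :: "('v \<times> bool) list \<Rightarrow> ('v \<times> bool) list \<Rightarrow> real" where
  "brooks u w = real (occurrence_count u w) - real (occurrence_count (inv_word u) w)"

definition quasi_additive :: "real \<Rightarrow> ('a list \<Rightarrow> real) \<Rightarrow> bool" where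
  "quasi_additive D f \<longleftrightarrow> (\<forall>a b. \<bar>f a + f b - f (a @ b)\<bar> \<le> D)"

lemma quasi_additiveD: "quasi_additive D f \<Longrightarrow> \<bar>f a + f b - f (a @ b)\<bar> \<le> D"
  by (simp add: quasi_additive_def)

lemma quasi_additive_sum:
  assumes "\<And>i. i \<in> I \<Longrightarrow> quasi_additive D (f i)"
  shows "quasi_additive (real (card I) * D) (\<lambda>w. \<Sum>i\<in>I. f i w)"
  unfolding quasi_additive_def
proof (intro allI)
  fix a b
  have "(\<Sum>i\<in>I. f i a) + (\<Sum>i\<in>I. f i b) - (\<Sum>i\<in>I. f i (a @ b))
      = (\<Sum>i\<in>I. f i a + f i b - f i (a @ b))"
    by (simp add: sum.distrib sum_subtractf)
  also have "\<bar>\<dots>\<bar> \<le> real (card I) * D"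
    using assms by (intro order.trans[OF sum_abs] sum_bounded_above quasi_additiveD)
  finally show "\<bar>(\<Sum>i\<in>I. f i a) + (\<Sum>i\<in>I. f i b) - (\<Sum>i\<in>I. f i (a @ b))\<bar> \<le> real (card I) * D" .
qed

lemma quasi_additive_conj:
  assumes "quasi_additive D f" "f (inv_word k) = - f k"
  shows "\<bar>f (k @ w @ inv_word k) - f w\<bar> \<le> 2 * D"
  using quasi_additiveD[OF assms(1), of k "w @ inv_word k"]
    quasi_additiveD[OF assms(1), of w "inv_word k"] assms(2) by simp

lemma brooks_inv_word: "brooks u (inv_word w) = - brooks u w"
proof -
  have "occurrence_count (inv_word v) (inv_word w) = occurrence_count v w" for v
    unfolding inv_word_def occurrence_count_rev
    by (rule occurrence_count_map[of _ UNIV]) (auto simp: inj_def)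
  from this[of u] this[of "inv_word u"] show ?thesis by (simp add: brooks_def)
qed

lemma brooks_map:
  assumes \<rho>: "inj_on \<rho> (S \<times> UNIV)" "\<And>z. \<rho> (inv_letter z) = inv_letter (\<rho> z)"
    and "u \<in> raag_words S" "w \<in> raag_words S"
  shows "brooks (map \<rho> u) (map \<rho> w) = brooks u w"
proof -
  have "occurrence_count (map \<rho> v) (map \<rho> w) = occurrence_count v w" if "v \<in> raag_words S" for v
    using \<rho>(1) that assms(4) by (intro occurrence_count_map) (auto simp: raag_words_def)
  moreover have "inv_word (map \<rho> u) = map \<rho> (inv_word u)" by (simp add: inv_word_def rev_map \<rho>(2))
  ultimately show ?thesis using assms(3) by (simp add: brooks_def)
qed

lemma brooks_quasi_additive:
  assumes "u \<noteq> []" shows "quasi_additive (real (length u)) (brooks u)"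
  unfolding quasi_additive_def
proof (intro allI)
  fix a b
  have "inv_word u \<noteq> []" using assms by simp
  then show "\<bar>brooks u a + brooks u b - brooks u (a @ b)\<bar> \<le> real (length u)"
    using occurrence_count_append_le[of u a b] occurrence_count_append_ge[OF assms, of a b]
      occurrence_count_append_le[of "inv_word u" a b]
      occurrence_count_append_ge[of "inv_word u" a b]
    by (simp add: brooks_def)
qed

lemma brooks_nf_quasi_additive:
  fixes u :: "('v \<times> bool) list"
  assumes "u \<noteq> []" shows "quasi_additive (3 * real (length u)) (\<lambda>w. brooks u (nf w))"
  unfolding quasi_additive_def
proof (intro allI)
  fix r s :: "('v \<times> bool) list"
  obtain a b c where rs: "nf r = a @ c" "nf s = inv_word c @ b" "reduced (a @ b)"
    using reduced_product_cancellation[OF reduced_nf reduced_nf] by metis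
  have "nf (r @ s) = nf (nf r @ nf s)" by (intro nf_append_cong) simp_all
  also have "\<dots> = nf (a @ b)" using rs nf_cancel(1)[of a c b] by simp
  also have "\<dots> = a @ b" using rs nf_reduced by blast
  finally have "nf (r @ s) = a @ b" .
  then show "\<bar>brooks u (nf r) + brooks u (nf s) - brooks u (nf (r @ s))\<bar> \<le> 3 * real (length u)"
    using brooks_quasi_additive[OF assms, THEN quasi_additiveD, of a c]
      brooks_quasi_additive[OF assms, THEN quasi_additiveD, of "inv_word c" b]
      brooks_quasi_additive[OF assms, THEN quasi_additiveD, of a b]
    by (simp add: rs brooks_inv_word)
qed

section \<open>Patterns and test words\<close>

definition pattern :: "nat \<Rightarrow> 'a \<Rightarrow> 'a \<Rightarrow> 'a list" where
  "pattern i s t = [t] @ replicate 2 s @ [t] @ replicate (i + 3) s @ [t]"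

definition test_word :: "nat \<Rightarrow> 'a \<Rightarrow> 'a \<Rightarrow> 'a list" where
  "test_word j s t = pattern j s t @ [s]"

text \<open>The accumulator \<open>c\<close> is the length of the run of letters other than \<open>t\<close> read so far.\<close>

primrec run_lengths :: "'a \<Rightarrow> nat \<Rightarrow> 'a list \<Rightarrow> nat list" where
  "run_lengths t c [] = []"
| "run_lengths t c (z # w) = (if z = t then c # run_lengths t 0 w else run_lengths t (Suc c) w)"

lemma set_pattern: "set (pattern i s t) = {s, t}"
  by (auto simp: pattern_def)

lemma pattern_neq_Nil [simp]: "pattern i s t \<noteq> []"
  by (simp add: pattern_def)

lemma length_pattern: "length (pattern i s t) = i + 8"
  by (simp add: pattern_def)

lemma map_pattern: "map f (pattern i s t) = pattern i (f s) (f t)"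
  by (simp add: pattern_def)

lemma inv_word_pattern: "inv_word (pattern i s t) = rev (pattern i (inv_letter s) (inv_letter t))"
  by (simp add: inv_word_def map_pattern)

lemma set_test_word: "set (test_word j s t) = {s, t}"
  by (auto simp: test_word_def set_pattern)

lemma run_lengths_replicate:
  "s \<noteq> t \<Longrightarrow> run_lengths t c (replicate n s @ w) = run_lengths t (c + n) w"
  by (induction n arbitrary: c) auto

lemma run_lengths_append:
  "\<exists>c'. \<forall>w. run_lengths t c (p @ w) = run_lengths t c p @ run_lengths t c' w"
proof (induction p arbitrary: c)
  case (Cons z p)
  show ?case using Cons.IH[of 0] Cons.IH[of "Suc c"] by auto
qed auto

lemma sublist_run_lengths:
  assumes "s \<noteq> t"
    and "sublist ([t] @ replicate m s @ [t] @ replicate n s @ [t]) w" (is "sublist ?u w")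
  shows "sublist [m, n] (run_lengths t c w)"
proof -
  obtain p q where w: "w = p @ ?u @ q" using assms(2) by (auto simp: sublist_def)
  obtain c' where "run_lengths t c w = run_lengths t c p @ run_lengths t c' (?u @ q)"
    using run_lengths_append w by metis
  also have "\<dots> = (run_lengths t c p @ [c']) @ [m, n] @ run_lengths t 0 q"
    using assms(1) by (simp add: run_lengths_replicate)
  finally show ?thesis unfolding sublist_def by blast
qed

lemma run_lengths_test_word_power:
  assumes "s \<noteq> t"
  shows "run_lengths t 1 (word_power (test_word j s t) n) = word_power [1, 2, j + 3] n"
proof (induction n)
  case (Suc n)
  then show ?case using assms
    by (simp add: test_word_def pattern_def run_lengths_replicate del: replicate.simps)
qed simp

lemma sublist_word_power_triple:
  assumes "sublist [m, n] (word_power [a, b, c] k)"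
  shows "(m, n) \<in> {(a, b), (b, c), (c, a)}"
  using assms
proof (induction k)
  case (Suc k)
  then show ?case by (cases k) (auto simp: sublist_Cons_right)
qed simp

lemma sublist_test_word_power:
  assumes "s \<noteq> t"
    and "sublist ([t] @ replicate m s @ [t] @ replicate n s @ [t]) (word_power (test_word j s t) k)"
  shows "(m, n) \<in> {(1, 2), (2, j + 3), (j + 3, 1)}"
  using sublist_run_lengths[OF assms, of 1]
  unfolding run_lengths_test_word_power[OF assms(1)] by (rule sublist_word_power_triple)

lemma sublist_pattern_test_word_power:
  assumes "s \<noteq> t" "sublist (pattern i s t) (word_power (test_word j s t) k)"
  shows "i = j"
  using sublist_test_word_power[OF assms(1), of 2 "i + 3" j k] assms(2) by (simp add: pattern_def)

lemma not_sublist_rev_pattern_test_word_power: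
  assumes "s \<noteq> t" shows "\<not> sublist (rev (pattern i s t)) (word_power (test_word j s t) k)"
  using sublist_test_word_power[OF assms, of "i + 3" 2 j k] by (auto simp: pattern_def)

text \<open>With the two letters exchanged, both a pattern and its reversal contain \<open>ttt\<close>, while runs
  of length zero do not occur in test words.\<close>

lemma not_sublist_swapped_pattern_test_word_power:
  assumes "s \<noteq> t"
  shows "\<not> sublist (pattern i t s) (word_power (test_word j s t) k)"
    "\<not> sublist (rev (pattern i t s)) (word_power (test_word j s t) k)"
proof -
  have "pattern i t s = ([s] @ replicate 2 t @ [s]) @ [t, t, t] @ (replicate i t @ [s])"
    by (simp add: pattern_def numeral_3_eq_3)
  then have "sublist [t, t, t] (pattern i t s)" by (metis sublist_appendI)
  moreover from this have "sublist [t, t, t] (rev (pattern i t s))"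
    using sublist_rev[of "[t, t, t]" "pattern i t s"] by simp
  moreover have "\<not> sublist [t, t, t] (word_power (test_word j s t) k)"
    using sublist_test_word_power[OF assms, of 0 0 j k] by auto
  ultimately show "\<not> sublist (pattern i t s) (word_power (test_word j s t) k)"
    "\<not> sublist (rev (pattern i t s)) (word_power (test_word j s t) k)"
    using sublist_order.order.trans by blast+
qed

definition pair_count ::
  "nat \<Rightarrow> 'v \<times> bool \<Rightarrow> 'v \<times> bool \<Rightarrow> ('v \<times> bool) list \<Rightarrow> real" where
  "pair_count i s t w = brooks (pattern i s t) (nf (retraction {fst s, fst t} w))"

lemma pair_count_quasi_additive: "quasi_additive (3 * real (i + 8)) (pair_count i s t)"
  using brooks_nf_quasi_additive[of "pattern i s t"] length_pattern[of i s t]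
  by (auto simp: quasi_additive_def pair_count_def)

context
  fixes a b :: "'v \<times> bool" and j n :: nat and w :: "('v \<times> bool) list"
  assumes ab: "fst a \<noteq> fst b"
  defines "w \<equiv> word_power (test_word j a b) n"
begin

lemma set_test_word_power: "set w \<subseteq> {a, b}"
  using set_word_power[of "test_word j a b" n] by (simp add: w_def set_test_word)

lemma nf_retraction_test_word_power: "nf (retraction S w) = retraction S w"
proof (intro nf_reduced reduced_if_no_inverse_letters notI)
  fix z assume "z \<in> set (retraction S w)" "inv_letter z \<in> set (retraction S w)"
  then have "z \<in> {a, b}" "inv_letter z \<in> {a, b}"
    using set_test_word_power by (auto simp: set_retraction)
  then show False using ab by (metis insertE singletonD inv_letter_neq(1) fst_inv_letter)
qed

lemma sublist_retraction_test_word_power: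
  assumes "set u = {s, t}" "fst s \<noteq> fst t" "sublist u (retraction {fst s, fst t} w)"
  shows "sublist u w" "(s, t) = (a, b) \<or> (s, t) = (b, a)"
proof -
  have "{s, t} \<subseteq> set (retraction {fst s, fst t} w)"
    using set_mono_sublist[OF assms(3)] assms(1) by simp
  then have "{s, t} \<subseteq> {a, b}" using set_test_word_power by (auto simp: set_retraction)
  then show st: "(s, t) = (a, b) \<or> (s, t) = (b, a)" using assms(2) by auto
  then have "retraction {fst s, fst t} w = w"
    using set_test_word_power by (intro retraction_id) (auto simp: raag_words_iff)
  then show "sublist u w" using assms(3) by simp
qed

lemma occurrence_count_inv_pattern_test_word_power:
  assumes "fst s \<noteq> fst t"
  shows "occurrence_count (inv_word (pattern i s t)) (retraction {fst s, fst t} w) = 0"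
  unfolding occurrence_count_eq_0_iff
proof
  let ?s = "inv_letter s" and ?t = "inv_letter t"
  assume "sublist (inv_word (pattern i s t)) (retraction {fst s, fst t} w)"
  then have "sublist (rev (pattern i ?s ?t)) (retraction {fst ?s, fst ?t} w)"
    by (simp add: inv_word_pattern)
  from sublist_retraction_test_word_power[OF _ _ this] assms
  have "sublist (rev (pattern i ?s ?t)) w" "(?s, ?t) = (a, b) \<or> (?s, ?t) = (b, a)"
    by (simp_all add: set_pattern)
  moreover have "a \<noteq> b" using ab by auto
  then have "\<not> sublist (rev (pattern i a b)) w" "\<not> sublist (rev (pattern i b a)) w"
    unfolding w_def
    by (rule not_sublist_rev_pattern_test_word_power,
        rule not_sublist_swapped_pattern_test_word_power)
  ultimately show False by auto
qed

lemma pair_count_test_word_power_eq_0: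
  assumes "fst s \<noteq> fst t" "(s, t) \<noteq> (a, b) \<or> i \<noteq> j" shows "pair_count i s t w = 0"
proof -
  have "\<not> sublist (pattern i s t) (retraction {fst s, fst t} w)"
  proof
    assume "sublist (pattern i s t) (retraction {fst s, fst t} w)"
    note occurs = sublist_retraction_test_word_power[OF set_pattern assms(1) this]
    have "a \<noteq> b" using ab by auto
    then have "\<not> sublist (pattern i b a) w"
      unfolding w_def by (rule not_sublist_swapped_pattern_test_word_power)
    moreover have "i = j" if "sublist (pattern i a b) w"
      using sublist_pattern_test_word_power[OF \<open>a \<noteq> b\<close>] that unfolding w_def by blast
    ultimately show False using occurs assms(2) by auto
  qed
  then have "occurrence_count (pattern i s t) (retraction {fst s, fst t} w) = 0"
    by (simp add: occurrence_count_eq_0_iff)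
  then show ?thesis
    using occurrence_count_inv_pattern_test_word_power[OF assms(1)]
    by (simp add: pair_count_def brooks_def nf_retraction_test_word_power)
qed

lemma pair_count_test_word_power_ge: "real n \<le> pair_count j a b w"
proof -
  let ?u = "pattern j a b" and ?t = "test_word j a b"
  have "sublist ?u ?t" by (simp add: test_word_def)
  then have "1 \<le> occurrence_count ?u ?t" using occurrence_count_eq_0_iff[of ?u ?t] by linarith
  have "m \<le> occurrence_count ?u (word_power ?t m)" for m
  proof (induction m)
    case (Suc m)
    show ?case
      using occurrence_count_append_ge[of ?u ?t "word_power ?t m"] Suc \<open>1 \<le> occurrence_count ?u ?t\<close>
      by simp
  qed simp
  moreover have "retraction {fst a, fst b} w = w"
    using set_test_word_power by (intro retraction_id) (auto simp: raag_words_iff)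
  ultimately show ?thesis
    using occurrence_count_inv_pattern_test_word_power[OF ab, of j]
      nf_retraction_test_word_power[of UNIV]
    by (simp add: pair_count_def brooks_def w_def)
qed

end

section \<open>Equality of words in a right angled Artin group\<close>

text \<open>For \<open>i \<noteq> j\<close> this is the coefficient of \<open>X\<^sub>i X\<^sub>j\<close> in the Magnus expansion.\<close>

primrec magnus_coeff :: "'v \<Rightarrow> 'v \<Rightarrow> ('v \<times> bool) list \<Rightarrow> int" where
  "magnus_coeff i j [] = 0"
| "magnus_coeff i j (z # w) = exponent i z * exponent_sum j w + magnus_coeff i j w"

lemma magnus_coeff_append [simp]:
  "magnus_coeff i j (a @ b) =
     magnus_coeff i j a + magnus_coeff i j b + exponent_sum i a * exponent_sum j b"
  by (induction a) (simp_all add: algebra_simps)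

definition in_band :: "'v set set \<Rightarrow> 'v \<Rightarrow> int \<Rightarrow> int \<Rightarrow> 'v \<times> bool \<Rightarrow> bool" where
  "in_band E l N h z \<longleftrightarrow> fst z \<in> st E l \<or> \<bar>h\<bar> \<le> N"

text \<open>The height \<open>h\<close> of a letter is the exponent sum in \<open>l\<close> of what precedes it.\<close>

primrec band_retraction ::
  "'v set set \<Rightarrow> 'v \<Rightarrow> int \<Rightarrow> int \<Rightarrow> ('v \<times> bool) list \<Rightarrow> ('v \<times> bool) list" where
  "band_retraction E l N h [] = []"
| "band_retraction E l N h (z # w) =
     (if in_band E l N h z then [z] else []) @ band_retraction E l N (h + exponent l z) w"

lemma band_retraction_append:
  "band_retraction E l N h (a @ b) =
     band_retraction E l N h a @ band_retraction E l N (h + exponent_sum l a) b"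
  by (induction a arbitrary: h) (simp_all add: add.assoc)

lemma band_retraction_near: "\<bar>h\<bar> + int (length w) \<le> N \<Longrightarrow> band_retraction E l N h w = w"
proof (induction w arbitrary: h)
  case (Cons z w)
  then show ?case using abs_exponent_le[of l z] by (simp add: in_band_def)
qed simp

lemma band_retraction_far:
  "N + int (length w) < \<bar>h\<bar> \<Longrightarrow> band_retraction E l N h w = retraction (st E l) w"
proof (induction w arbitrary: h)
  case (Cons z w)
  then show ?case using abs_exponent_le[of l z] by (simp add: in_band_def)
qed simp

lemma band_retraction_in_raag_words: "w \<in> raag_words S \<Longrightarrow> band_retraction E l N h w \<in> raag_words S"
  by (induction w arbitrary: h) auto

lemma lk_sym: "x \<in> lk E y \<longleftrightarrow> y \<in> lk E x"
  by (simp add: lk_def insert_commute)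

lemma st_sym: "x \<in> st E y \<longleftrightarrow> y \<in> st E x"
  using lk_sym[of x E y] by (auto simp: st_def)

lemma in_band_exponent_shift:
  "fst y \<in> st E (fst z) \<Longrightarrow> in_band E l N (h + exponent l y) z \<longleftrightarrow> in_band E l N h z"
  by (cases "fst y = l") (auto simp: in_band_def exponent_def st_sym[of l])

locale raag =
  fixes V :: "'v set" and E :: "'v set set"
  assumes graph: "finite_graph V E"
begin

abbreviation eqv (infix "\<doteq>" 50) where "a \<doteq> b \<equiv> raag_equiv V E a b"

abbreviation words where "words \<equiv> raag_words V"

abbreviation commute where "commute a b \<equiv> a @ b \<doteq> b @ a"

lemma finite_V: "finite V"
  using graph by (simp add: finite_graph_def)

lemma edgeD: "{u, v} \<in> E \<Longrightarrow> u \<noteq> v \<and> u \<in> V \<and> v \<in> V"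
  using graph unfolding finite_graph_def by fastforce

lemma lk_subset: "lk E v \<subseteq> V"
  using edgeD by (auto simp: lk_def)

lemma lk_irrefl: "v \<notin> lk E v"
  using edgeD[of v v] by (auto simp: lk_def)

lemma st_subset: "v \<in> V \<Longrightarrow> st E v \<subseteq> V"
  using lk_subset by (auto simp: st_def)

lemma eqv_refl [simp, intro!]: "a \<doteq> a"
  by (simp add: raag_equiv_def)

lemma eqv_trans [trans]: "a \<doteq> b \<Longrightarrow> b \<doteq> c \<Longrightarrow> a \<doteq> c"
  unfolding raag_equiv_def by (rule rtranclp_trans)

lemma raag_step_sym: "raag_step V E a b \<Longrightarrow> raag_step V E b a"
proof (induction rule: raag_step.induct)
  case (cancel v xs b ys)
  then show ?case by (rule raag_step.insert)
next
  case (insert v xs ys b)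
  then show ?case by (rule raag_step.cancel)
next
  case (swap u w xs b c ys)
  then show ?case using raag_step.swap[of w u] by (simp add: insert_commute)
qed

lemma eqv_sym: "a \<doteq> b \<Longrightarrow> b \<doteq> a"
  unfolding raag_equiv_def
  by (induction rule: rtranclp_induct) (auto intro: converse_rtranclp_into_rtranclp raag_step_sym)

lemma equivp_eqv: "equivp eqv"
  by (auto intro: equivpI reflpI sympI transpI eqv_sym eqv_trans)

lemma class_eq_iff: "raag_class V E a = raag_class V E b \<longleftrightarrow> a \<doteq> b"
  unfolding raag_class_def using eqv_refl eqv_trans eqv_sym by blast

lemma eqv_respects:
  assumes R: "equivp R" and "a \<doteq> b"
    and cancel_letters: "\<And>xs z ys. fst z \<in> V \<Longrightarrow> R (f (xs @ [z, inv_letter z] @ ys)) (f (xs @ ys))"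
    and swap_letters: "\<And>xs y z ys. {fst y, fst z} \<in> E \<Longrightarrow>
      R (f (xs @ [y, z] @ ys)) (f (xs @ [z, y] @ ys))"
  shows "R (f a) (f b)"
proof -
  have step: "R (f a) (f b)" if "raag_step V E a b" for a b
    using that
  proof (induction rule: raag_step.induct)
    case (cancel v xs b ys)
    then show ?case using cancel_letters[of "(v, b)" xs ys] by (simp add: inv_letter_def)
  next
    case (insert v xs ys b)
    then show ?case
      using cancel_letters[of "(v, b)" xs ys] equivp_symp[OF R] by (simp add: inv_letter_def)
  next
    case (swap u w xs b c ys)
    then show ?case using swap_letters[of "(u, b)" "(w, c)"] by simp
  qed
  show ?thesis using \<open>a \<doteq> b\<close> unfolding raag_equiv_def
    by (induction rule: rtranclp_induct) (auto intro: equivp_reflp[OF R] equivp_transp[OF R] step)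
qed

lemma eqv_cancel_context: "fst z \<in> V \<Longrightarrow> xs @ [z, inv_letter z] @ ys \<doteq> xs @ ys"
  using raag_step.cancel[of "fst z" V E xs "snd z" ys]
  by (simp add: raag_equiv_def inv_letter_def r_into_rtranclp)

lemma eqv_swap_context: "{fst y, fst z} \<in> E \<Longrightarrow> xs @ [y, z] @ ys \<doteq> xs @ [z, y] @ ys"
  using raag_step.swap[of "fst y" "fst z" E V xs "snd y" "snd z" ys]
  by (simp add: raag_equiv_def r_into_rtranclp)

lemma eqv_context: "a \<doteq> b \<Longrightarrow> p @ a @ q \<doteq> p @ b @ q"
proof (rule eqv_respects[OF equivp_eqv, where f = "\<lambda>a. p @ a @ q"], assumption)
  show "p @ (xs @ [z, inv_letter z] @ ys) @ q \<doteq> p @ (xs @ ys) @ q" if "fst z \<in> V" for xs z ys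
    using eqv_cancel_context[OF that, of "p @ xs" "ys @ q"] by simp
  show "p @ (xs @ [y, z] @ ys) @ q \<doteq> p @ (xs @ [z, y] @ ys) @ q"
    if "{fst y, fst z} \<in> E" for xs y z ys
    using eqv_swap_context[OF that, of "p @ xs" "ys @ q"] by simp
qed

lemma eqv_append: "a \<doteq> b \<Longrightarrow> c \<doteq> d \<Longrightarrow> a @ c \<doteq> b @ d"
  using eqv_context[of a b "[]" c] eqv_context[of c d b "[]"] eqv_trans by simp

lemma eqv_words: "a \<doteq> b \<Longrightarrow> a \<in> words \<longleftrightarrow> b \<in> words"
  by (rule eqv_respects[OF identity_equivp]) (auto dest: edgeD)

lemma eqv_exponent_sum: "a \<doteq> b \<Longrightarrow> exponent_sum v a = exponent_sum v b"
  by (rule eqv_respects[OF identity_equivp]) auto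

lemma eqv_retraction: "a \<doteq> b \<Longrightarrow> retraction S a \<doteq> retraction S b"
proof (rule eqv_respects[OF equivp_eqv, where f = "retraction S"], assumption)
  show "retraction S (xs @ [z, inv_letter z] @ ys) \<doteq> retraction S (xs @ ys)"
    if "fst z \<in> V" for xs z ys
    using eqv_cancel_context[OF that, of "retraction S xs" "retraction S ys"] by auto
  show "retraction S (xs @ [y, z] @ ys) \<doteq> retraction S (xs @ [z, y] @ ys)"
    if "{fst y, fst z} \<in> E" for xs y z ys
    using eqv_swap_context[OF that, of "retraction S xs" "retraction S ys"] by auto
qed

lemma eqv_magnus_coeff:
  assumes "j \<notin> st E i" "a \<doteq> b"
  shows "magnus_coeff i j a = magnus_coeff i j b"
  using identity_equivp assms(2)
proof (rule eqv_respects)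
  show "magnus_coeff i j (xs @ [z, inv_letter z] @ ys) = magnus_coeff i j (xs @ ys)" for xs z ys
  proof -
    have "exponent i z * exponent j z = 0" using assms(1) by (auto simp: exponent_def st_def)
    then show ?thesis by (simp add: algebra_simps)
  qed
  show "magnus_coeff i j (xs @ [y, z] @ ys) = magnus_coeff i j (xs @ [z, y] @ ys)"
    if "{fst y, fst z} \<in> E" for xs y z ys
  proof -
    have "exponent i y * exponent j z = 0" "exponent i z * exponent j y = 0"
      using assms(1) that by (auto simp: exponent_def st_def lk_def insert_commute)
    then show ?thesis by (auto simp: algebra_simps)
  qed
qed

lemma commute_exponent_sum:
  "commute g h \<Longrightarrow> j \<notin> st E i \<Longrightarrow>
     exponent_sum i g * exponent_sum j h = exponent_sum j g * exponent_sum i h"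
  using eqv_magnus_coeff[of j i "g @ h" "h @ g"] by simp

lemma eqv_nf_retraction:
  assumes "y \<notin> st E x" "a \<doteq> b" shows "nf (retraction {x, y} a) = nf (retraction {x, y} b)"
  using identity_equivp assms(2)
proof (rule eqv_respects[where f = "\<lambda>w. nf (retraction {x, y} w)"])
  show "nf (retraction {x, y} (xs @ [z, inv_letter z] @ ys)) = nf (retraction {x, y} (xs @ ys))"
    for xs z ys
    using nf_cancel(1)[of "retraction {x, y} xs" "[z]"] by simp
  show "nf (retraction {x, y} (xs @ [u, v] @ ys)) = nf (retraction {x, y} (xs @ [v, u] @ ys))"
    if "{fst u, fst v} \<in> E" for xs u v ys
  proof -
    have "\<not> (fst u \<in> {x, y} \<and> fst v \<in> {x, y})"
      using assms(1) that edgeD[OF that] by (auto simp: st_def lk_def insert_commute)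
    then show ?thesis by auto
  qed
qed

lemma eqv_band_retraction:
  assumes "a \<doteq> b" shows "band_retraction E l N h a \<doteq> band_retraction E l N h b"
  using equivp_eqv assms
proof (rule eqv_respects)
  fix xs ys
  define h' where "h' = h + exponent_sum l xs"
  have split: "band_retraction E l N h (xs @ u @ ys) = band_retraction E l N h xs
      @ band_retraction E l N h' u @ band_retraction E l N (h' + exponent_sum l u) ys" for u
    by (simp add: band_retraction_append h'_def)
  show "band_retraction E l N h (xs @ [z, inv_letter z] @ ys) \<doteq> band_retraction E l N h (xs @ ys)"
    if "fst z \<in> V" for z
  proof -
    have "band_retraction E l N h' [z, inv_letter z]
        = (if in_band E l N h' z then [z, inv_letter z] else [])"
      using in_band_exponent_shift[of z E "inv_letter z"] by (simp add: in_band_def st_def)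
    then show ?thesis
      using split[of "[z, inv_letter z]"] split[of "[]"] eqv_cancel_context[OF that] by auto
  qed
  show "band_retraction E l N h (xs @ [y, z] @ ys) \<doteq> band_retraction E l N h (xs @ [z, y] @ ys)"
    if "{fst y, fst z} \<in> E" for y z
  proof -
    have "fst y \<in> st E (fst z)" "fst z \<in> st E (fst y)"
      using that by (auto simp: st_def lk_def insert_commute)
    from this[THEN in_band_exponent_shift] show ?thesis
      using split[of "[y, z]"] split[of "[z, y]"] eqv_swap_context[OF that] by (auto simp: add_ac)
  qed
qed

lemma nf_eqv: "w \<in> words \<Longrightarrow> nf w \<doteq> w"
proof (induction w)
  case (Cons z w)
  have "cons_reduce z r \<doteq> [z] @ r" for r
    using eqv_cancel_context[of z "[]", THEN eqv_sym] Cons.prems by (cases r) auto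
  also have "[z] @ nf w \<doteq> [z] @ w" using Cons by (intro eqv_append) auto
  finally show ?case by simp
qed simp

lemma eqv_if_nf_eq: "nf a = nf b \<Longrightarrow> a \<in> words \<Longrightarrow> b \<in> words \<Longrightarrow> a \<doteq> b"
  by (metis nf_eqv eqv_sym eqv_trans)

lemma append_inv_word_eqv: "w \<in> words \<Longrightarrow> w @ inv_word w \<doteq> []"
  and inv_word_append_eqv: "w \<in> words \<Longrightarrow> inv_word w @ w \<doteq> []"
  using nf_append_inv_word[of w] nf_append_inv_word[of "inv_word w"]
  by (auto intro: eqv_if_nf_eq)

lemma eqv_inverse_unique:
  assumes "a \<in> words" "a @ b \<doteq> []" shows "b \<doteq> inv_word a"
proof -
  have "b \<doteq> (inv_word a @ a) @ b"
    using eqv_append[OF eqv_sym[OF inv_word_append_eqv[OF assms(1)]] eqv_refl[of b]] by simp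
  also have "\<dots> \<doteq> inv_word a" using eqv_append[OF eqv_refl[of "inv_word a"] assms(2)] by simp
  finally show ?thesis .
qed

lemma eqv_inv_word:
  assumes "a \<doteq> b" "a \<in> words" shows "inv_word a \<doteq> inv_word b"
proof -
  have "a @ inv_word b \<doteq> b @ inv_word b" using assms(1) by (intro eqv_append) auto
  also have "\<dots> \<doteq> []" using append_inv_word_eqv eqv_words assms by blast
  finally show ?thesis using eqv_inverse_unique assms(2) eqv_sym by blast
qed

lemma eqv_single_letter:
  assumes "fst z \<in> V" "w \<in> raag_words {fst z}" "exponent_sum (fst z) w = exponent (fst z) z"
  shows "w \<doteq> [z]"
proof -
  have "w \<in> words" using assms(1,2) by (auto simp: raag_words_iff)
  obtain n b where nf: "nf w = replicate n (fst z, b)"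
    using reduced_single_generator[OF reduced_nf nf_in_raag_words[OF assms(2)]] by blast
  then have "int n * exponent (fst z) (fst z, b) = exponent (fst z) z"
    using eqv_exponent_sum[OF nf_eqv[OF \<open>w \<in> words\<close>]] assms(3) by simp
  then have "n = 1" "b = snd z" by (auto simp: exponent_def split: if_splits)
  then have "nf w = [z]" using nf by simp
  then show ?thesis using nf_eqv[OF \<open>w \<in> words\<close>] eqv_sym by simp
qed

lemma commute_word_power: "commute g h \<Longrightarrow> commute g (word_power h n)"
proof (induction n)
  case (Suc n)
  have "(g @ h) @ word_power h n \<doteq> (h @ g) @ word_power h n"
    using Suc.prems eqv_append by blast
  also have "\<dots> \<doteq> h @ word_power h n @ g"
    using eqv_append[OF eqv_refl Suc.IH[OF Suc.prems]] by simp
  finally show ?case by simp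
qed simp

definition conj_to_retraction :: "'v set \<Rightarrow> ('v \<times> bool) list \<Rightarrow> bool" where
  "conj_to_retraction S g \<longleftrightarrow> (\<exists>u\<in>words. g \<doteq> u @ retraction S g @ inv_word u)"

text \<open>Passing to the kernel of the exponent sum of \<open>l\<close>, a conjugate of the shift induced by a power
  of \<open>h\<close> fixes \<open>g\<close>; letters outside the star of \<open>l\<close> are shifted away from themselves,
  so they can be deleted up to conjugation.\<close>

lemma conj_to_retraction_star:
  assumes g: "g \<in> words" "exponent_sum l g = 0" and h: "h \<in> words" "exponent_sum l h \<noteq> 0"
    and "commute g h"
  shows "conj_to_retraction (st E l) g"
proof -
  define N where "N = int (length g)"
  define n where "n = 2 * length g + 1"
  define u where "u = band_retraction E l N 0 (word_power h n)"
  have u: "u \<in> words"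
    unfolding u_def by (intro band_retraction_in_raag_words word_power_in_raag_words h)
  have "int n * 1 \<le> int n * \<bar>exponent_sum l h\<bar>" using h by (intro mult_left_mono) auto
  moreover have "int n = N + int (length g) + 1" by (simp add: n_def N_def)
  ultimately have "N + int (length g) < \<bar>int n * exponent_sum l h\<bar>" unfolding abs_mult by linarith
  then have far: "band_retraction E l N (int n * exponent_sum l h) g = retraction (st E l) g"
    by (rule band_retraction_far)
  have near: "band_retraction E l N 0 g = g" by (rule band_retraction_near) (simp add: N_def)
  have "g @ u \<doteq> u @ retraction (st E l) g"
    using eqv_band_retraction[OF commute_word_power[OF \<open>commute g h\<close>, of n], of l N 0] g(2)
    by (simp add: band_retraction_append near far u_def)
  then have "(g @ u) @ inv_word u \<doteq> (u @ retraction (st E l) g) @ inv_word u"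
    by (rule eqv_append) simp
  moreover have "g \<doteq> g @ u @ inv_word u"
    using eqv_append[OF eqv_refl[of g] append_inv_word_eqv[OF u]] eqv_sym by simp
  ultimately show ?thesis unfolding conj_to_retraction_def using u eqv_trans by auto
qed

lemma conj_to_retraction_Int:
  assumes "conj_to_retraction S g" "conj_to_retraction T g" shows "conj_to_retraction (S \<inter> T) g"
proof -
  obtain u v where u: "u \<in> words" "g \<doteq> u @ retraction S g @ inv_word u"
    and v: "v \<in> words" "g \<doteq> v @ retraction T g @ inv_word v"
    using assms unfolding conj_to_retraction_def by blast
  have "retraction S g \<doteq> retraction S v @ retraction (S \<inter> T) g @ inv_word (retraction S v)"
    using eqv_retraction[OF v(2), of S] by (simp add: retraction_inv_word)
  from eqv_context[OF this, of u "inv_word u"]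
  have "g \<doteq> (u @ retraction S v) @ retraction (S \<inter> T) g @ inv_word (u @ retraction S v)"
    using u(2) eqv_trans by simp
  moreover have "u @ retraction S v \<in> words" using u v by simp
  ultimately show ?thesis unfolding conj_to_retraction_def by blast
qed

lemma conj_to_retraction_INT:
  assumes "finite I" "\<And>i. i \<in> I \<Longrightarrow> conj_to_retraction (S i) g"
  shows "conj_to_retraction (\<Inter>i\<in>I. S i) g"
  using assms
proof (induction I rule: finite_induct)
  case empty
  show ?case unfolding conj_to_retraction_def by (intro bexI[of _ "[]"]) simp_all
next
  case (insert i I)
  then show ?case using conj_to_retraction_Int[of "S i" g "\<Inter>i\<in>I. S i"] by simp
qed

end

section \<open>Homomorphisms and their action on exponent sums\<close>

locale raag_hom = raag V E
  for V :: "'v set" and E :: "'v set set" +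
  fixes \<Phi> :: "('v \<times> bool) list \<Rightarrow> ('v \<times> bool) list"
  assumes image_words: "w \<in> words \<Longrightarrow> \<Phi> w \<in> words"
    and image_append: "a \<in> words \<Longrightarrow> b \<in> words \<Longrightarrow> \<Phi> (a @ b) \<doteq> \<Phi> a @ \<Phi> b"
    and image_cong: "a \<in> words \<Longrightarrow> a \<doteq> b \<Longrightarrow> \<Phi> a \<doteq> \<Phi> b"
begin

abbreviation gen :: "'v \<Rightarrow> ('v \<times> bool) list" where "gen v \<equiv> [(v, True)]"

definition image_exponent :: "'v \<Rightarrow> 'v \<Rightarrow> int" where
  "image_exponent s v = exponent_sum s (\<Phi> (gen v))"

lemma image_Nil: "\<Phi> [] \<doteq> []"
proof -
  let ?e = "\<Phi> []"
  have e: "?e \<in> words" by (simp add: image_words)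
  have "?e \<doteq> (inv_word ?e @ ?e) @ ?e"
    using eqv_append[OF eqv_sym[OF inv_word_append_eqv[OF e]] eqv_refl[of ?e]] by simp
  also have "\<dots> \<doteq> inv_word ?e @ ?e"
    using eqv_append[OF eqv_refl eqv_sym[OF image_append[of "[]" "[]"]]] by simp
  also have "\<dots> \<doteq> []" using e by (rule inv_word_append_eqv)
  finally show ?thesis .
qed

lemma image_inv_word:
  assumes "w \<in> words" shows "\<Phi> (inv_word w) \<doteq> inv_word (\<Phi> w)"
proof (rule eqv_inverse_unique[OF image_words[OF assms]])
  have "\<Phi> w @ \<Phi> (inv_word w) \<doteq> \<Phi> (w @ inv_word w)" using image_append assms eqv_sym by simp
  also have "\<dots> \<doteq> \<Phi> []" using image_cong append_inv_word_eqv assms by simp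
  also have "\<dots> \<doteq> []" by (rule image_Nil)
  finally show "\<Phi> w @ \<Phi> (inv_word w) \<doteq> []" .
qed

lemma commute_image_gen:
  assumes "v \<in> V" "u \<in> st E v" shows "commute (\<Phi> (gen u)) (\<Phi> (gen v))"
proof -
  have u: "u \<in> V" using assms st_subset by blast
  have "commute (gen u) (gen v)"
    using assms(2) eqv_swap_context[of "(u, True)" "(v, True)" "[]" "[]"]
    by (auto simp: st_def lk_def insert_commute)
  have "\<Phi> (gen u) @ \<Phi> (gen v) \<doteq> \<Phi> (gen u @ gen v)"
    using assms(1) u by (intro eqv_sym[OF image_append]) simp_all
  also have "\<dots> \<doteq> \<Phi> (gen v @ gen u)"
    using \<open>commute (gen u) (gen v)\<close> assms(1) u by (intro image_cong) simp_all
  also have "\<dots> \<doteq> \<Phi> (gen v) @ \<Phi> (gen u)" using assms(1) u by (intro image_append) simp_all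
  finally show ?thesis .
qed

lemma exponent_sum_image_letter:
  assumes "fst z \<in> V" shows "exponent_sum s (\<Phi> [z]) = exponent (fst z) z * image_exponent s (fst z)"
proof (cases z)
  case (Pair v b)
  then show ?thesis
    using eqv_exponent_sum[OF image_inv_word[of "gen v"], of s] assms
    by (cases b) (simp_all add: image_exponent_def exponent_def inv_letter_def)
qed

lemma exponent_sum_image:
  assumes "w \<in> words"
  shows "exponent_sum s (\<Phi> w) = (\<Sum>v\<in>V. exponent_sum v w * image_exponent s v)"
  using assms
proof (induction w)
  case Nil
  then show ?case using eqv_exponent_sum[OF image_Nil, of s] by simp
next
  case (Cons z w)
  have "(\<Sum>v\<in>V. exponent v z * image_exponent s v) = exponent (fst z) z * image_exponent s (fst z)"
    using Cons.prems finite_V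
    by (subst sum.remove[of V "fst z"]) (auto simp: exponent_def intro!: sum.neutral)
  also have "\<dots> = exponent_sum s (\<Phi> [z])" using exponent_sum_image_letter Cons.prems by simp
  finally show ?case
    using eqv_exponent_sum[OF image_append[of "[z]" w], of s] Cons
    by (simp add: sum.distrib distrib_right)
qed

lemma image_star_combination:
  assumes v: "v \<in> V" and d: "\<And>j. j \<notin> st E v \<Longrightarrow> d j = 0" and "t \<notin> st E l"
  shows "(\<Sum>j\<in>V. d j * image_exponent l j) * image_exponent t v
       = (\<Sum>j\<in>V. d j * image_exponent t j) * image_exponent l v"
  unfolding sum_distrib_right
proof (rule sum.cong[OF refl])
  fix j
  show "d j * image_exponent l j * image_exponent t v
      = d j * image_exponent t j * image_exponent l v"
  proof (cases "j \<in> st E v")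
    case True
    from commute_exponent_sum[OF commute_image_gen[OF v this] \<open>t \<notin> st E l\<close>]
    show ?thesis by (simp add: image_exponent_def)
  qed (simp add: d)
qed

end

locale raag_aut = raag_hom V E \<Phi> + inverse: raag_hom V E \<Psi>
  for V :: "'v set" and E :: "'v set set" and \<Phi> \<Psi> :: "('v \<times> bool) list \<Rightarrow> ('v \<times> bool) list" +
  assumes inverse_image: "w \<in> words \<Longrightarrow> \<Psi> (\<Phi> w) \<doteq> w"
    and image_inverse: "w \<in> words \<Longrightarrow> \<Phi> (\<Psi> w) \<doteq> w"
begin

lemma raag_aut_inverse: "raag_aut V E \<Psi> \<Phi>"
  by unfold_locales (fact inverse_image image_inverse)+

lemma sum_image_exponent_inverse:
  assumes "v \<in> V"
  shows "(\<Sum>w\<in>V. image_exponent w v * inverse.image_exponent s w) = (if s = v then 1 else 0)"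
proof -
  have "exponent_sum s (\<Psi> (\<Phi> (gen v)))
      = (\<Sum>w\<in>V. image_exponent w v * inverse.image_exponent s w)"
    using inverse.exponent_sum_image[OF image_words] assms by (simp add: image_exponent_def)
  moreover have "exponent_sum s (\<Psi> (\<Phi> (gen v))) = exponent_sum s (gen v)"
    using eqv_exponent_sum[OF inverse_image] assms by simp
  ultimately show ?thesis by (auto simp: exponent_def)
qed

end

sublocale raag_aut \<subseteq> inverse: raag_aut V E \<Psi> \<Phi>
  by (rule raag_aut_inverse)

context raag_aut
begin

lemma dual_generator:
  assumes "v \<in> V"
  obtains w where "w \<in> V" "image_exponent w v \<noteq> 0" "inverse.image_exponent v w \<noteq> 0"
proof -
  have "(\<Sum>w\<in>V. image_exponent w v * inverse.image_exponent v w) \<noteq> 0"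
    using sum_image_exponent_inverse[OF assms, of v] by simp
  then obtain w where "w \<in> V" "image_exponent w v * inverse.image_exponent v w \<noteq> 0"
    by (rule sum.not_neutral_contains_not_neutral)
  then show thesis using that by auto
qed

text \<open>Up to a scalar and a multiple of \<open>w\<close>, each \<open>l\<close> in the link of \<open>w\<close> is the image of a vector
  supported on the star of \<open>v\<close>, hence commutes with the image of \<open>v\<close> in degree two.\<close>

lemma image_exponent_support_star:
  assumes v: "v \<in> V" and w: "w \<in> V" and l: "l \<in> lk E w"
    and "inverse.image_exponent v w \<noteq> 0" "image_exponent s v \<noteq> 0"
  shows "s \<in> st E l"
proof (rule ccontr)
  assume s: "s \<notin> st E l"
  have "l \<in> V" "l \<noteq> w" using l lk_subset lk_irrefl by auto
  have "s \<noteq> w" "s \<noteq> l" using s l lk_sym[of l] by (auto simp: st_def)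
  let ?M = "inverse.image_exponent"
  define d where "d j = ?M v w * ?M j l - ?M v l * ?M j w" for j
  have d_support: "d j = 0" if "j \<notin> st E v" for j
    using commute_exponent_sum[OF inverse.commute_image_gen[of w l] that] l w
    by (simp add: d_def inverse.image_exponent_def st_def)
  have image_d: "(\<Sum>j\<in>V. d j * image_exponent k j)
      = ?M v w * (if k = l then 1 else 0) - ?M v l * (if k = w then 1 else 0)" for k
    unfolding inverse.sum_image_exponent_inverse[OF \<open>l \<in> V\<close>, symmetric]
      inverse.sum_image_exponent_inverse[OF w, symmetric]
    by (simp only: d_def left_diff_distrib sum_subtractf sum_distrib_left mult.assoc)
  show False
    using image_star_combination[of v d, OF v d_support s] assms(4,5) \<open>l \<noteq> w\<close> \<open>s \<noteq> w\<close> \<open>s \<noteq> l\<close>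
    by (simp add: image_d)
qed

end

section \<open>The right angled Artin group and maps of words\<close>

context raag
begin

abbreviation cls where "cls \<equiv> raag_class V E"

lemma carrier_RAAG: "carrier (RAAG V E) = cls ` words"
  and one_RAAG: "\<one>\<^bsub>RAAG V E\<^esub> = cls []"
  by (simp_all add: RAAG_def)

lemma cls_in_carrier: "w \<in> words \<Longrightarrow> cls w \<in> carrier (RAAG V E)"
  by (simp add: carrier_RAAG)

lemma mult_RAAG: "cls a \<otimes>\<^bsub>RAAG V E\<^esub> cls b = cls (a @ b)"
proof -
  have "(\<exists>a'\<in>cls a. \<exists>b'\<in>cls b. a' @ b' \<doteq> w) \<longleftrightarrow> a @ b \<doteq> w" for w
    unfolding raag_class_def using eqv_append eqv_trans eqv_refl by blast
  then show ?thesis by (simp add: RAAG_def raag_class_def[of V E "a @ b"])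
qed

lemma group_RAAG: "group (RAAG V E)"
proof (rule groupI)
  fix g assume "g \<in> carrier (RAAG V E)"
  then obtain w where w: "w \<in> words" "g = cls w" by (auto simp: carrier_RAAG)
  have "cls (inv_word w) \<otimes>\<^bsub>RAAG V E\<^esub> g = \<one>\<^bsub>RAAG V E\<^esub>"
    using inv_word_append_eqv w by (simp add: mult_RAAG one_RAAG class_eq_iff)
  then show "\<exists>h\<in>carrier (RAAG V E). h \<otimes>\<^bsub>RAAG V E\<^esub> g = \<one>\<^bsub>RAAG V E\<^esub>"
    using w by (auto simp: carrier_RAAG)
qed (auto simp: carrier_RAAG one_RAAG mult_RAAG)

sublocale RAAG: group "RAAG V E"
  by (rule group_RAAG)

lemma cls_word_power: "cls w [^]\<^bsub>RAAG V E\<^esub> n = cls (word_power w n)"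
  by (induction n) (simp_all add: one_RAAG mult_RAAG word_power_Suc_right del: word_power_Suc)

definition rep :: "('v \<times> bool) list set \<Rightarrow> ('v \<times> bool) list" where
  "rep g = (SOME w. w \<in> words \<and> cls w = g)"

lemma rep_words: "g \<in> carrier (RAAG V E) \<Longrightarrow> rep g \<in> words"
  and cls_rep: "g \<in> carrier (RAAG V E) \<Longrightarrow> cls (rep g) = g"
  using someI_ex[of "\<lambda>w. w \<in> words \<and> cls w = g"] by (auto simp: rep_def carrier_RAAG)

lemma rep_cls: "w \<in> words \<Longrightarrow> rep (cls w) \<doteq> w"
  using cls_rep[OF cls_in_carrier] by (simp add: class_eq_iff)

lemma hom_raag_hom:
  assumes "\<chi> \<in> hom (RAAG V E) (RAAG V E)" shows "raag_hom V E (\<lambda>w. rep (\<chi> (cls w)))"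
proof unfold_locales
  have closed: "\<chi> (cls w) \<in> carrier (RAAG V E)" if "w \<in> words" for w
    using hom_in_carrier[OF assms] cls_in_carrier that by blast
  then show "rep (\<chi> (cls w)) \<in> words" if "w \<in> words" for w using rep_words that by blast
  show "rep (\<chi> (cls (a @ b))) \<doteq> rep (\<chi> (cls a)) @ rep (\<chi> (cls b))"
    if ab: "a \<in> words" "b \<in> words" for a b
  proof -
    have "cls (rep (\<chi> (cls (a @ b)))) = \<chi> (cls a \<otimes>\<^bsub>RAAG V E\<^esub> cls b)"
      using closed ab by (simp add: cls_rep mult_RAAG)
    also have "\<dots> = \<chi> (cls a) \<otimes>\<^bsub>RAAG V E\<^esub> \<chi> (cls b)"
      using hom_mult[OF assms] ab cls_in_carrier by blast
    also have "\<dots> = cls (rep (\<chi> (cls a)) @ rep (\<chi> (cls b)))"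
      using closed ab by (simp add: cls_rep flip: mult_RAAG)
    finally show ?thesis by (simp add: class_eq_iff)
  qed
  show "rep (\<chi> (cls a)) \<doteq> rep (\<chi> (cls b))" if "a \<doteq> b" for a b
    using class_eq_iff[of a b] that by simp
qed

lemma iso_raag_aut:
  assumes \<phi>: "\<phi> \<in> iso (RAAG V E) (RAAG V E)"
  defines "\<theta> \<equiv> inv_into (carrier (RAAG V E)) \<phi>"
  shows "raag_aut V E (\<lambda>w. rep (\<phi> (cls w))) (\<lambda>w. rep (\<theta> (cls w)))"
proof -
  have "\<theta> \<in> iso (RAAG V E) (RAAG V E)" unfolding \<theta>_def using RAAG.iso_set_sym[OF \<phi>] .
  then have hom: "\<phi> \<in> hom (RAAG V E) (RAAG V E)" "\<theta> \<in> hom (RAAG V E) (RAAG V E)"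
    using \<phi> by (simp_all add: iso_def)
  have bij: "bij_betw \<phi> (carrier (RAAG V E)) (carrier (RAAG V E))" using \<phi> by (simp add: iso_def)
  interpret \<Phi>: raag_hom V E "\<lambda>w. rep (\<phi> (cls w))" using hom(1) by (rule hom_raag_hom)
  interpret \<Psi>: raag_hom V E "\<lambda>w. rep (\<theta> (cls w))" using hom(2) by (rule hom_raag_hom)
  show ?thesis
  proof unfold_locales
    fix w assume "w \<in> words"
    note w = cls_in_carrier[OF this]
    have "\<phi> (cls w) \<in> carrier (RAAG V E)" "\<theta> (cls w) \<in> carrier (RAAG V E)"
      using hom_in_carrier[OF hom(1) w] hom_in_carrier[OF hom(2) w] .
    then have "cls (rep (\<theta> (cls (rep (\<phi> (cls w)))))) = cls w"
      "cls (rep (\<phi> (cls (rep (\<theta> (cls w)))))) = cls w"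
      using bij_betw_inv_into_left[OF bij w] bij_betw_inv_into_right[OF bij w] w
      by (simp_all add: cls_rep \<theta>_def)
    then show "rep (\<theta> (cls (rep (\<phi> (cls w))))) \<doteq> w" "rep (\<phi> (cls (rep (\<theta> (cls w))))) \<doteq> w"
      by (simp_all add: class_eq_iff)
  qed
qed

end

section \<open>Automorphisms in the absence of dominated vertices\<close>

locale undominated_raag = raag V E
  for V :: "'v set" and E :: "'v set set" +
  assumes undominated: "x \<in> V \<Longrightarrow> y \<in> V \<Longrightarrow> lk E x \<subseteq> st E y \<Longrightarrow> x = y"

locale undominated_raag_aut = undominated_raag V E + raag_aut V E \<Phi> \<Psi>
  for V :: "'v set" and E :: "'v set set" and \<Phi> \<Psi> :: "('v \<times> bool) list \<Rightarrow> ('v \<times> bool) list"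
begin

lemma undominated_raag_aut_inverse: "undominated_raag_aut V E \<Psi> \<Phi>"
  by unfold_locales

end

sublocale undominated_raag_aut \<subseteq> inverse: undominated_raag_aut V E \<Psi> \<Phi>
  by (rule undominated_raag_aut_inverse)

context undominated_raag_aut
begin

lemma image_exponent_support:
  assumes "v \<in> V" "w \<in> V" "inverse.image_exponent v w \<noteq> 0" "image_exponent s v \<noteq> 0"
  shows "s = w"
proof -
  have "s \<in> V"
    using exponent_sum_eq_0[OF image_words, of "gen v" s] assms by (auto simp: image_exponent_def)
  moreover have "lk E w \<subseteq> st E s"
    using image_exponent_support_star[OF assms(1,2) _ assms(3,4)] st_sym by (metis subsetI)
  ultimately show ?thesis using undominated assms by blast
qed

definition gen_image :: "'v \<Rightarrow> 'v" where
  "gen_image v = (THE s. image_exponent s v \<noteq> 0)"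

lemma gen_image:
  assumes "v \<in> V"
  shows image_exponent_neq_0_iff: "image_exponent s v \<noteq> 0 \<longleftrightarrow> s = gen_image v"
    and gen_image_in: "gen_image v \<in> V"
    and inverse_image_exponent_neq_0: "inverse.image_exponent v (gen_image v) \<noteq> 0"
proof -
  obtain w where w: "w \<in> V" "image_exponent w v \<noteq> 0" "inverse.image_exponent v w \<noteq> 0"
    using dual_generator assms by blast
  have unique: "s = w" if "image_exponent s v \<noteq> 0" for s
    using image_exponent_support assms w that by blast
  then have "gen_image v = w" unfolding gen_image_def using w by (intro the_equality)
  then show "image_exponent s v \<noteq> 0 \<longleftrightarrow> s = gen_image v" "gen_image v \<in> V"
    "inverse.image_exponent v (gen_image v) \<noteq> 0"
    using w unique by metis+
qed

lemma image_exponent_gen_image: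
  assumes "v \<in> V"
  shows "image_exponent (gen_image v) v = 1 \<or> image_exponent (gen_image v) v = - 1"
proof -
  have "1 = (\<Sum>w\<in>V. image_exponent w v * inverse.image_exponent v w)"
    using sum_image_exponent_inverse[OF assms, of v] by simp
  also have "\<dots> = (\<Sum>w\<in>{gen_image v}. image_exponent w v * inverse.image_exponent v w)"
    using finite_V gen_image_in image_exponent_neq_0_iff assms
    by (intro sum.mono_neutral_right) auto
  finally have "image_exponent (gen_image v) v * inverse.image_exponent v (gen_image v) = 1" by simp
  then show ?thesis by (metis zmult_eq_1_iff)
qed

end

context undominated_raag_aut
begin

lemma inverse_gen_image [simp]: "v \<in> V \<Longrightarrow> inverse.gen_image (gen_image v) = v"
  using inverse.image_exponent_neq_0_iff gen_image_in inverse_image_exponent_neq_0 by metis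

lemma gen_image_star:
  assumes "v \<in> V" "u \<in> st E v" shows "gen_image u \<in> st E (gen_image v)"
proof (rule ccontr)
  assume nonadjacent: "gen_image u \<notin> st E (gen_image v)"
  have "u \<in> V" using assms st_subset by blast
  have "image_exponent (gen_image v) u * image_exponent (gen_image u) v
      = image_exponent (gen_image u) u * image_exponent (gen_image v) v"
    using commute_exponent_sum[OF commute_image_gen[OF assms] nonadjacent]
    by (simp add: image_exponent_def)
  moreover have "image_exponent (gen_image u) u * image_exponent (gen_image v) v \<noteq> 0"
    using image_exponent_neq_0_iff \<open>u \<in> V\<close> \<open>v \<in> V\<close> by simp
  ultimately have "image_exponent (gen_image v) u \<noteq> 0" by (metis mult_zero_left)
  then have "gen_image v = gen_image u" using image_exponent_neq_0_iff[OF \<open>u \<in> V\<close>] by simp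
  then show False using nonadjacent by (simp add: st_def)
qed

end

context undominated_raag_aut
begin

lemma gen_image_star_iff:
  assumes "u \<in> V" "v \<in> V" shows "gen_image u \<in> st E (gen_image v) \<longleftrightarrow> u \<in> st E v"
  using gen_image_star[of v u] inverse.gen_image_star[of "gen_image v" "gen_image u"]
    assms gen_image_in by auto

lemma bij_betw_gen_image: "bij_betw gen_image V V"
  by (rule bij_betw_byWitness[where f' = inverse.gen_image])
    (auto simp: gen_image_in inverse.gen_image_in intro: inverse.inverse_gen_image)

definition letter_image :: "'v \<times> bool \<Rightarrow> 'v \<times> bool" where
  "letter_image z =
     (gen_image (fst z), snd z \<longleftrightarrow> image_exponent (gen_image (fst z)) (fst z) = 1)"

lemma fst_letter_image [simp]: "fst (letter_image z) = gen_image (fst z)"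
  by (simp add: letter_image_def)

lemma letter_image_inv_letter: "letter_image (inv_letter z) = inv_letter (letter_image z)"
  by (auto simp: letter_image_def inv_letter_def)

lemma bij_betw_letter_image: "bij_betw letter_image (V \<times> UNIV) (V \<times> UNIV)"
proof (rule bij_betw_imageI)
  have "inj_on gen_image V" "gen_image ` V = V"
    using bij_betw_gen_image by (simp_all add: bij_betw_def)
  then show inj: "inj_on letter_image (V \<times> UNIV)"
    by (auto simp: inj_on_def letter_image_def)
  have "letter_image z \<in> V \<times> UNIV" if "z \<in> V \<times> UNIV" for z
    using that gen_image_in by (simp add: mem_Times_iff)
  then have "letter_image ` (V \<times> UNIV) \<subseteq> V \<times> UNIV" by blast
  then show "letter_image ` (V \<times> UNIV) = V \<times> UNIV"
    using finite_V inj by (intro endo_inj_surj) auto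
qed

lemma image_conj_to_retraction_star:
  assumes "v \<in> V" "l \<in> lk E (gen_image v)" shows "conj_to_retraction (st E l) (\<Phi> (gen v))"
proof (rule conj_to_retraction_star)
  define m where "m = inverse.gen_image l"
  have "l \<in> V" "l \<noteq> gen_image v" using assms(2) lk_subset lk_irrefl by auto
  then have m: "m \<in> V" "gen_image m = l"
    by (simp_all add: m_def inverse.gen_image_in)
  then have "m \<in> st E v" using assms gen_image_star_iff[of m v] by (simp add: st_def)
  then show "commute (\<Phi> (gen v)) (\<Phi> (gen m))" using commute_image_gen assms eqv_sym by blast
  show "\<Phi> (gen v) \<in> words" "\<Phi> (gen m) \<in> words" using image_words assms m by simp_all
  show "exponent_sum l (\<Phi> (gen v)) = 0" "exponent_sum l (\<Phi> (gen m)) \<noteq> 0"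
    using image_exponent_neq_0_iff[of v l] image_exponent_neq_0_iff[of m l] assms(1) m
      \<open>l \<noteq> gen_image v\<close>
    by (simp_all add: image_exponent_def)
qed

lemma image_gen_conj:
  assumes "v \<in> V"
  shows "\<exists>k\<in>words. \<Phi> (gen v) \<doteq> k @ [letter_image (v, True)] @ inv_word k"
proof -
  let ?g = "\<Phi> (gen v)" and ?w = "gen_image v"
  let ?S = "\<Inter>l\<in>lk E ?w. st E l"
  have g: "?g \<in> words" and w: "?w \<in> V" using assms image_words gen_image_in by simp_all
  have "finite (lk E ?w)" using lk_subset finite_V finite_subset by blast
  then have "conj_to_retraction ?S ?g"
    using image_conj_to_retraction_star[OF assms] by (rule conj_to_retraction_INT)
  then obtain k where k: "k \<in> words" "?g \<doteq> k @ retraction ?S ?g @ inv_word k"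
    by (auto simp: conj_to_retraction_def)
  have "s = ?w" if "s \<in> ?S" "s \<in> V" for s
    using that undominated[OF w] st_sym by (metis INT_iff subsetI)
  then have "retraction ?S ?g \<in> raag_words {?w}"
    using g by (auto simp: raag_words_iff set_retraction)
  moreover have "exponent_sum ?w (retraction ?S ?g) = image_exponent ?w v"
    by (subst exponent_sum_retraction) (auto simp: image_exponent_def st_def lk_sym)
  then have "exponent_sum ?w (retraction ?S ?g) = exponent ?w (letter_image (v, True))"
    using image_exponent_gen_image[OF assms] by (auto simp: exponent_def letter_image_def)
  ultimately have "retraction ?S ?g \<doteq> [letter_image (v, True)]"
    using w by (intro eqv_single_letter) simp_all
  from eqv_context[OF this, of k "inv_word k"] show ?thesis using k eqv_trans by blast
qed

theorem image_letter_conj: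
  "\<exists>k. \<forall>z. fst z \<in> V \<longrightarrow> \<Phi> [z] \<doteq> k (fst z) @ [letter_image z] @ inv_word (k (fst z))"
proof -
  obtain k where k: "\<And>v. v \<in> V \<Longrightarrow> \<Phi> (gen v) \<doteq> k v @ [letter_image (v, True)] @ inv_word (k v)"
    using image_gen_conj by metis
  have "\<Phi> [z] \<doteq> k (fst z) @ [letter_image z] @ inv_word (k (fst z))" if v: "fst z \<in> V" for z
  proof (cases "snd z")
    case True
    then show ?thesis using k[OF v] by (cases z) simp
  next
    case False
    then have z: "z = inv_letter (fst z, True)" by (cases z) (simp add: inv_letter_def)
    have "\<Phi> [z] \<doteq> inv_word (\<Phi> (gen (fst z)))"
      using image_inv_word[of "gen (fst z)"] v z by simp
    also have "\<dots> \<doteq> inv_word (k (fst z) @ [letter_image (fst z, True)] @ inv_word (k (fst z)))"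
      using k[OF v] v by (intro eqv_inv_word) (simp_all add: image_words)
    also have "\<dots> = k (fst z) @ [letter_image z] @ inv_word (k (fst z))"
      by (subst (4) z) (simp add: letter_image_inv_letter inv_word_Cons)
    finally show ?thesis .
  qed
  then show ?thesis by blast
qed

lemma nf_retraction_image:
  assumes k: "\<And>z. fst z \<in> V \<Longrightarrow> \<Phi> [z] \<doteq> k (fst z) @ [letter_image z] @ inv_word (k (fst z))"
    and xy: "x \<in> V" "y \<in> V" "y \<notin> st E x" and w: "w \<in> words"
  defines "S \<equiv> {gen_image x, gen_image y}"
  shows "nf (retraction S (\<Phi> w)) =
    nf (concat (map (conj_letter (\<lambda>u. retraction S (k (inverse.gen_image u))))
      (map letter_image (retraction {x, y} w))))"
    (is "_ = nf (?subst w)")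
proof -
  have nonadjacent: "gen_image y \<notin> st E (gen_image x)" using gen_image_star_iff xy by simp
  show ?thesis
    using w
  proof (induction w)
    case Nil
    then show ?case using eqv_nf_retraction[OF nonadjacent image_Nil] by (simp add: S_def)
  next
    case (Cons z w)
    let ?k = "retraction S (k (fst z))"
    have z: "fst z \<in> V" "w \<in> words" using Cons.prems by simp_all
    have mem: "gen_image (fst z) \<in> S \<longleftrightarrow> fst z \<in> {x, y}"
      using z xy inverse_gen_image unfolding S_def by (metis insert_iff singletonD)
    have "nf (retraction S (\<Phi> [z])) = nf (?k @ retraction S [letter_image z] @ inv_word ?k)"
      using eqv_nf_retraction[OF nonadjacent k[OF z(1)]] by (simp add: S_def retraction_inv_word)
    also have "\<dots> = nf (?subst [z])"
      using mem z by (simp add: conj_letter_def nf_append_inv_word)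
    finally have letter: "nf (retraction S (\<Phi> [z])) = nf (?subst [z])" .
    have "nf (retraction S (\<Phi> (z # w))) = nf (retraction S (\<Phi> [z]) @ retraction S (\<Phi> w))"
      using eqv_nf_retraction[OF nonadjacent image_append[of "[z]" w]] z by (simp add: S_def)
    also have "\<dots> = nf (?subst [z] @ ?subst w)"
      using Cons.IH z letter by (intro nf_append_cong)
    finally show ?case by simp
  qed
qed

theorem nf_retraction_image_conj:
  assumes xy: "x \<in> V" "y \<in> V" "y \<notin> st E x"
  shows "\<exists>k. \<forall>w\<in>words. nf (retraction {gen_image x, gen_image y} (\<Phi> w)) =
           nf (k @ map letter_image (retraction {x, y} w) @ inv_word k)"
proof -
  let ?S = "{gen_image x, gen_image y}" and ?s = "\<lambda>w. map letter_image (retraction {x, y} w)"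
  obtain k where k: "\<And>z. fst z \<in> V \<Longrightarrow> \<Phi> [z] \<doteq> k (fst z) @ [letter_image z] @ inv_word (k (fst z))"
    using image_letter_conj by blast
  define \<kappa> where "\<kappa> = (\<lambda>u. retraction ?S (k (inverse.gen_image u)))"
  have image: "nf (retraction ?S (\<Phi> w)) = nf (concat (map (conj_letter \<kappa>) (?s w)))"
    if "w \<in> words" for w
    using k xy that unfolding \<kappa>_def by (rule nf_retraction_image)
  have distinct: "gen_image x \<noteq> gen_image y"
    using xy inverse_gen_image by (metis insertI1 st_def)
  have nonadjacent: "gen_image y \<notin> st E (gen_image x)" and "?S \<subseteq> V"
    using gen_image_star_iff gen_image_in xy by auto
  have relabelled_words: "?s w \<in> raag_words ?S" for w by (auto simp: raag_words_iff set_retraction)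
  have "\<exists>K. \<forall>z. fst z \<in> ?S \<longrightarrow> nf (conj_letter \<kappa> z) = nf (K @ [z] @ inv_word K)"
  proof (rule inner_if_conj_letters_generate[OF distinct])
    show "\<kappa> (gen_image x) \<in> raag_words ?S" "\<kappa> (gen_image y) \<in> raag_words ?S"
      by (simp_all add: \<kappa>_def)
    fix v assume v: "v \<in> raag_words ?S"
    then have "v \<in> words" using \<open>?S \<subseteq> V\<close> by (auto simp: raag_words_iff)
    then have "nf (concat (map (conj_letter \<kappa>) (?s (\<Psi> v)))) = nf v"
      using image[OF inverse.image_words[OF \<open>v \<in> words\<close>]]
        eqv_nf_retraction[OF nonadjacent image_inverse[OF \<open>v \<in> words\<close>]]
        retraction_id[OF v] by simp
    then show "\<exists>w\<in>raag_words ?S. nf (concat (map (conj_letter \<kappa>) w)) = nf v"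
      using relabelled_words by blast
  qed
  then obtain K where K: "\<And>z. fst z \<in> ?S \<Longrightarrow> nf (conj_letter \<kappa> z) = nf (K @ [z] @ inv_word K)"
    by blast
  have "nf (retraction ?S (\<Phi> w)) = nf (K @ ?s w @ inv_word K)" if "w \<in> words" for w
  proof -
    have "nf (conj_letter \<kappa> z) = nf (K @ [z] @ inv_word K)" if "z \<in> set (?s w)" for z
      using that relabelled_words[of w] by (intro K) (auto simp: raag_words_iff)
    from nf_concat_map_conj[of "?s w" "conj_letter \<kappa>" K "\<lambda>z. [z]", OF this]
    show ?thesis using image[OF that] by (simp del: map_map)
  qed
  then show ?thesis by blast
qed

end

section \<open>Counting over all pairs of nonadjacent letters\<close>

context raag
begin

definition nonadjacent_letters :: "(('v \<times> bool) \<times> ('v \<times> bool)) set" where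
  "nonadjacent_letters = {(s, t). fst s \<in> V \<and> fst t \<in> V \<and> fst t \<notin> st E (fst s)}"

definition total_count :: "nat \<Rightarrow> ('v \<times> bool) list \<Rightarrow> real" where
  "total_count i w = (\<Sum>(s, t)\<in>nonadjacent_letters. pair_count i s t w)"

lemma finite_nonadjacent_letters: "finite nonadjacent_letters"
  by (rule finite_subset[of _ "(V \<times> UNIV) \<times> (V \<times> UNIV)"])
    (auto simp: nonadjacent_letters_def finite_V)

lemma total_count_cong: "a \<doteq> b \<Longrightarrow> total_count i a = total_count i b"
  unfolding total_count_def
  by (intro sum.cong refl) (auto simp: nonadjacent_letters_def pair_count_def eqv_nf_retraction)

lemma total_count_quasi_additive:
  "quasi_additive (real (card nonadjacent_letters) * (3 * real (i + 8))) (total_count i)"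
  using quasi_additive_sum[of nonadjacent_letters _ "\<lambda>p. pair_count i (fst p) (snd p)",
      OF pair_count_quasi_additive]
  by (simp add: total_count_def[abs_def] case_prod_unfold)

lemma total_count_test_word_power:
  assumes "(a, b) \<in> nonadjacent_letters"
  shows "total_count i (word_power (test_word j a b) n)
       = pair_count i a b (word_power (test_word j a b) n)"
proof -
  let ?w = "word_power (test_word j a b) n"
  have distinct: "fst s \<noteq> fst t" if "(s, t) \<in> nonadjacent_letters" for s t
    using that by (auto simp: nonadjacent_letters_def st_def)
  have "pair_count i s t ?w = 0" if "(s, t) \<in> nonadjacent_letters - {(a, b)}" for s t
    using that by (intro pair_count_test_word_power_eq_0 distinct assms) auto
  then have "total_count i ?w = (\<Sum>(s, t)\<in>{(a, b)}. pair_count i s t ?w)"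
    unfolding total_count_def
    using assms finite_nonadjacent_letters by (intro sum.mono_neutral_right) auto
  then show ?thesis by simp
qed

definition class_count :: "nat \<Rightarrow> ('v \<times> bool) list set \<Rightarrow> real" where
  "class_count i g = total_count i (rep g)"

lemma class_count_cls: "w \<in> words \<Longrightarrow> class_count i (cls w) = total_count i w"
  unfolding class_count_def by (intro total_count_cong rep_cls)

lemma quasimorphism_class_count: "quasimorphism (RAAG V E) (class_count i)"
proof -
  let ?D = "real (card nonadjacent_letters) * (3 * real (i + 8))"
  have "\<bar>class_count i g + class_count i h - class_count i (g \<otimes>\<^bsub>RAAG V E\<^esub> h)\<bar> \<le> ?D"
    if "g \<in> carrier (RAAG V E)" "h \<in> carrier (RAAG V E)" for g h
    using that quasi_additiveD[OF total_count_quasi_additive]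
    by (auto simp: carrier_RAAG mult_RAAG class_count_cls)
  then show ?thesis unfolding quasimorphism_def by blast
qed

lemma pair_count_test_word_power_growth:
  assumes ab: "(a, b) \<in> nonadjacent_letters"
    and \<psi>: "homogeneous (RAAG V E) \<psi>" "bounded_difference (carrier (RAAG V E)) \<psi> (class_count i)"
  shows "bounded_difference UNIV (\<lambda>n. pair_count i a b (word_power (test_word j a b) n))
           (\<lambda>n. real n * \<psi> (cls (test_word j a b)))"
proof -
  let ?t = "test_word j a b"
  have words: "word_power ?t n \<in> words" for n
    using set_word_power[of ?t n] ab
    by (auto simp: raag_words_iff set_test_word nonadjacent_letters_def)
  from words[of 1] have t: "?t \<in> words" by simp
  have "bounded_difference UNIV (\<psi> \<circ> (\<lambda>n. cls (word_power ?t n)))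
      (class_count i \<circ> (\<lambda>n. cls (word_power ?t n)))"
    using \<psi>(2) by (rule bounded_difference_comp) (use cls_in_carrier words in blast)
  moreover have "\<psi> (cls (word_power ?t n)) = real n * \<psi> (cls ?t)" for n
    using RAAG.homogeneous_nat_pow[OF \<psi>(1) cls_in_carrier[OF t]] by (simp add: cls_word_power)
  ultimately show ?thesis
    by (simp add: comp_def class_count_cls[OF words] total_count_test_word_power[OF ab]
        bounded_difference_sym)
qed

lemma homogenization_test_word_neq_0_iff:
  assumes ab: "(a, b) \<in> nonadjacent_letters"
    and \<psi>: "homogeneous (RAAG V E) \<psi>" "bounded_difference (carrier (RAAG V E)) \<psi> (class_count i)"
  shows "\<psi> (cls (test_word j a b)) \<noteq> 0 \<longleftrightarrow> i = j"
proof -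
  let ?t = "test_word j a b"
  have "fst a \<noteq> fst b" using ab by (auto simp: nonadjacent_letters_def st_def)
  note growth = pair_count_test_word_power_growth[OF ab \<psi>, of j]
  show ?thesis
  proof (cases "i = j")
    case True
    have "\<psi> (cls ?t) \<noteq> 0"
    proof
      assume "\<psi> (cls ?t) = 0"
      then obtain C where "\<And>n. \<bar>pair_count j a b (word_power ?t n)\<bar> \<le> C"
        using growth True by (auto simp: bounded_difference_def)
      then have "real n \<le> C" for n
        using pair_count_test_word_power_ge[OF \<open>fst a \<noteq> fst b\<close>, of n j] abs_le_D1 order.trans
        by blast
      then show False using reals_Archimedean2[of C] by (meson not_le)
    qed
    then show ?thesis using True by simp
  next
    case False
    then have "bounded_difference UNIV (\<lambda>n. pair_count i a b (word_power ?t n)) (\<lambda>n. real n * 0)"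
      using pair_count_test_word_power_eq_0[OF \<open>fst a \<noteq> fst b\<close> \<open>fst a \<noteq> fst b\<close>]
      by (auto simp: bounded_difference_def)
    with growth have "\<psi> (cls ?t) = 0" by (rule slope_unique)
    then show ?thesis using False by simp
  qed
qed

end

context undominated_raag_aut
begin

lemma pair_count_image:
  assumes st: "(s, t) \<in> nonadjacent_letters" and w: "w \<in> words"
  shows "\<bar>pair_count i (letter_image s) (letter_image t) (\<Phi> w) - pair_count i s t w\<bar>
    \<le> 6 * real (i + 8)"
proof -
  let ?S = "{fst s, fst t}" and ?u = "pattern i s t"
  let ?v = "retraction ?S w" and ?f = "\<lambda>w. brooks (map letter_image (pattern i s t)) (nf w)"
  have S: "fst s \<in> V" "fst t \<in> V" "fst t \<notin> st E (fst s)"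
    using st by (auto simp: nonadjacent_letters_def)
  obtain k where "nf (retraction {gen_image (fst s), gen_image (fst t)} (\<Phi> w))
      = nf (k @ map letter_image ?v @ inv_word k)"
    using nf_retraction_image_conj[OF S] w by blast
  then have image: "pair_count i (letter_image s) (letter_image t) (\<Phi> w)
      = ?f (k @ map letter_image ?v @ inv_word k)"
    by (simp add: pair_count_def map_pattern)
  have conjugation: "\<bar>?f (k @ map letter_image ?v @ inv_word k) - ?f (map letter_image ?v)\<bar>
      \<le> 2 * (3 * length (map letter_image ?u))"
    using quasi_additive_conj[OF brooks_nf_quasi_additive,
        of "map letter_image ?u" k "map letter_image ?v"]
    by (simp add: nf_inv_word brooks_inv_word)
  have inj: "inj_on letter_image (?S \<times> UNIV)"
    using bij_betw_letter_image S(1,2) by (auto simp: bij_betw_def intro: inj_on_subset)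
  have "nf (map letter_image ?v) = map letter_image (nf ?v)"
    using nf_map[where \<rho> = letter_image, OF inj] letter_image_inv_letter by simp
  moreover have "pattern i s t \<in> raag_words ?S" by (simp add: raag_words_iff set_pattern)
  moreover have "nf ?v \<in> raag_words ?S" by (simp add: nf_in_raag_words)
  ultimately have relabelling: "?f (map letter_image ?v) = pair_count i s t w"
    using brooks_map[where \<rho> = letter_image, OF inj] letter_image_inv_letter
    by (simp add: pair_count_def)
  show ?thesis using conjugation by (simp add: image relabelling length_pattern)
qed

lemma bij_betw_nonadjacent_letters:
  "bij_betw (map_prod letter_image letter_image) nonadjacent_letters nonadjacent_letters"
proof (rule bij_betw_imageI)
  let ?p = "map_prod letter_image letter_image"
  have "inj_on ?p ((V \<times> UNIV) \<times> (V \<times> UNIV))"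
    using bij_betw_letter_image by (intro map_prod_inj_on) (auto simp: bij_betw_def)
  then show inj: "inj_on ?p nonadjacent_letters"
    by (rule inj_on_subset) (auto simp: nonadjacent_letters_def)
  have "?p ` nonadjacent_letters \<subseteq> nonadjacent_letters"
    using gen_image_in gen_image_star_iff by (auto simp: nonadjacent_letters_def)
  then show "?p ` nonadjacent_letters = nonadjacent_letters"
    using inj by (intro endo_inj_surj finite_nonadjacent_letters)
qed

lemma total_count_image: "bounded_difference words (total_count i \<circ> \<Phi>) (total_count i)"
proof (rule bounded_differenceI)
  fix w assume w: "w \<in> words"
  have "(total_count i \<circ> \<Phi>) w
      = (\<Sum>(s, t)\<in>nonadjacent_letters. pair_count i (letter_image s) (letter_image t) (\<Phi> w))"
    using sum.reindex_bij_betw[OF bij_betw_nonadjacent_letters,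
        of "\<lambda>(s, t). pair_count i s t (\<Phi> w)"]
    by (simp add: total_count_def case_prod_unfold)
  then have "(total_count i \<circ> \<Phi>) w - total_count i w = (\<Sum>(s, t)\<in>nonadjacent_letters.
      pair_count i (letter_image s) (letter_image t) (\<Phi> w) - pair_count i s t w)"
    by (simp add: total_count_def case_prod_unfold sum_subtractf)
  also have "\<bar>\<dots>\<bar> \<le> real (card nonadjacent_letters) * (6 * real (i + 8))"
    using pair_count_image[OF _ w] by (intro order.trans[OF sum_abs] sum_bounded_above) auto
  finally show "\<bar>(total_count i \<circ> \<Phi>) w - total_count i w\<bar>
      \<le> real (card nonadjacent_letters) * (6 * real (i + 8))" .
qed

end

context undominated_raag
begin

lemma class_count_aut:
  assumes \<phi>: "\<phi> \<in> iso (RAAG V E) (RAAG V E)"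
  shows "bounded_difference (carrier (RAAG V E)) (class_count i \<circ> \<phi>) (class_count i)"
proof -
  interpret raag_aut V E "\<lambda>w. rep (\<phi> (cls w))" "\<lambda>w. rep (inv_into (carrier (RAAG V E)) \<phi> (cls w))"
    using \<phi> by (rule iso_raag_aut)
  interpret undominated_raag_aut V E "\<lambda>w. rep (\<phi> (cls w))"
    "\<lambda>w. rep (inv_into (carrier (RAAG V E)) \<phi> (cls w))" ..
  show ?thesis
    using total_count_image[of i] unfolding bounded_difference_def carrier_RAAG
    by (simp add: class_count_cls) (simp add: class_count_def)
qed

lemma aut_invariant_class_count:
  "\<exists>\<psi>. quasimorphism (RAAG V E) \<psi> \<and> homogeneous (RAAG V E) \<psi> \<and> aut_invariant (RAAG V E) \<psi>
     \<and> bounded_difference (carrier (RAAG V E)) \<psi> (class_count i)"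
  using RAAG.aut_invariant_homogenization[OF quasimorphism_class_count class_count_aut] by metis

lemma nonadjacent_letters_nonempty:
  assumes "card V \<ge> 2" shows "nonadjacent_letters \<noteq> {}"
proof -
  obtain x y where xy: "x \<in> V" "y \<in> V" "x \<noteq> y"
    using assms by (auto simp: numeral_2_eq_2 card_le_Suc_iff)
  then obtain z where "z \<in> lk E x" "z \<notin> st E y" using undominated by blast
  then have "((y, True), (z, True)) \<in> nonadjacent_letters"
    using xy lk_subset by (auto simp: nonadjacent_letters_def)
  then show ?thesis by blast
qed

end

theorem theorem1p2:
  fixes V :: "'v set" and E :: "'v set set"
  assumes "finite_graph V E"
    and "card V \<ge> 2"
    and "\<not> (\<exists>x\<in>V. \<exists>y\<in>V. x \<noteq> y \<and> lk E x \<subseteq> st E y)"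
  shows "\<exists>Q :: nat \<Rightarrow> ('v \<times> bool) list set \<Rightarrow> real.
           lin_indep_fun (RAAG V E) Q UNIV \<and>
           (\<forall>i. quasimorphism (RAAG V E) (Q i) \<and> homogeneous (RAAG V E) (Q i)
                \<and> aut_invariant (RAAG V E) (Q i))"
proof -
  interpret undominated_raag V E using assms(1,3) by unfold_locales blast+
  obtain a b where ab: "(a, b) \<in> nonadjacent_letters"
    using nonadjacent_letters_nonempty[OF assms(2)] by auto
  obtain Q where Q: "\<And>i. quasimorphism (RAAG V E) (Q i)" "\<And>i. homogeneous (RAAG V E) (Q i)"
    "\<And>i. aut_invariant (RAAG V E) (Q i)"
    "\<And>i. bounded_difference (carrier (RAAG V E)) (Q i) (class_count i)"
    using aut_invariant_class_count by metis
  have "lin_indep_fun (RAAG V E) Q UNIV"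
  proof (rule lin_indep_fun_if_dual)
    show "cls (test_word j a b) \<in> carrier (RAAG V E)" for j
      using ab by (intro cls_in_carrier)
        (auto simp: raag_words_iff set_test_word nonadjacent_letters_def)
    show "Q i (cls (test_word j a b)) \<noteq> 0 \<longleftrightarrow> i = j" for i j
      using homogenization_test_word_neq_0_iff[OF ab Q(2,4)] .
  qed
  then show ?thesis using Q by blast
qed

end
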